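(* Let $p\ge3$, let $X\in\mathbb R^p$ have a spherically symmetric density $f(\|x-\theta\|)$, and let $F(u)=\int_u^\infty sf(s)ds$. Then the generalized Bayes estimator of $\theta$ under quadratic loss with respect to the harmonic prior $g(\theta)=\|\theta\|^{2-p}$ is written as $$\delta_*(X)=\left(1-\frac{\int_0^1t^{p-1}F(t\|X\|)dt}{\int_0^1t^{p-3}F(t\|X\|)dt}\right)X .$$
   Context: $\|\cdot\|$ is the Euclidean norm. The generalized Bayes estimator with respect to $g$ is $$\delta_*(x)=\frac{\int_{\mathbb R^p}\theta f(\|x-\theta\|)\|\theta\|^{2-p}d\theta}{\int_{\mathbb R^p}f(\|x-\theta\|)\|\theta\|^{2-p}d\theta},$$ which is understood to be well-defined, i.e. the integrals involved are finite for all $x$. *)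

theory Defs
  imports "HOL-Probability.Probability"
begin

text \<open>
  The sampling density of \<open>x\<close> given \<open>\<theta>\<close> is \<open>f (norm (x - \<theta>))\<close>; only the values of \<open>f\<close> on
  \<open>{0..}\<close> matter.  For a prior density \<open>g\<close>, possibly improper, the generalized Bayes estimator under
  quadratic loss is the posterior mean.
\<close>

definition gen_bayes ::
    "(real \<Rightarrow> real) \<Rightarrow> (real ^ 'p \<Rightarrow> real) \<Rightarrow> real ^ 'p \<Rightarrow> real ^ 'p" where
  "gen_bayes f g x =
     (LINT \<theta>|lborel. (f (norm (x - \<theta>)) * g \<theta>) *\<^sub>R \<theta>)
       /\<^sub>R (LINT \<theta>|lborel. f (norm (x - \<theta>)) * g \<theta>)"

definition gen_bayes_well_defined ::
    "(real \<Rightarrow> real) \<Rightarrow> (real ^ 'p \<Rightarrow> real) \<Rightarrow> bool" where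
  "gen_bayes_well_defined f g \<longleftrightarrow>
     (\<forall>x. integrable lborel (\<lambda>\<theta>. (f (norm (x - \<theta>)) * g \<theta>) *\<^sub>R \<theta>) \<and>
          integrable lborel (\<lambda>\<theta>. f (norm (x - \<theta>)) * g \<theta>))"

text \<open>At the origin \<open>powr\<close> yields \<open>0\<close> rather than infinity; this affects a null set only.\<close>

definition harmonic_prior :: "real ^ 'p \<Rightarrow> real" where
  "harmonic_prior \<theta> = norm \<theta> powr (2 - real CARD('p))"

definition tail_F :: "(real \<Rightarrow> real) \<Rightarrow> real \<Rightarrow> real" where
  "tail_F f u = (LINT s:{u..}|lborel. s * f s)"

end

(* Write y = x - \<theta> and r = |x|.  The claim amounts to the two radial identities
     const * \<integral> f(|y|) |x - y|^(2-p) dy   = \<integral>_0^1 t^(p-3) F(tr) dt,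
     const * \<integral> f(|y|) |x - y|^(2-p) y dy = (\<integral>_0^1 t^(p-1) F(tr) dt) x.
   For the Gaussian f(s) = exp(-l s^2) they follow by writing |x - y|^(2-p) as a Gamma mixture of
   the Gaussians exp(-m |x - y|^2), completing the square, and substituting m = l t^2 / (1 - t^2).
   Both sides are integrals of f against fixed (possibly signed) measures on the half-line, and such
   a measure is determined by its integrals against Gaussians: in the variable exp(-s^2) these are
   the moments of a measure on [0,1].  Hence the identities hold for every f. *)
theory Submission imports Defs begin

subsection \<open>Measures on the half-line are determined by Gaussian integrals\<close>

text \<open>The measures in question have infinite mass, so they are first weighted by exp(-s^2);
  the n-th moment in the variable v = exp(-s^2) is then a Gaussian integral with parameter n + 1.
  Signed measures are never formed as objects: each is given by a density \<open>k\<close> on some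
  measure space together with a statistic \<open>S\<close>, and integrating \<open>g\<close> against
  it means integrating \<open>k * g(S)\<close>. The main obstacle is integrability. Comparing the
  integrals of an unbounded function requires it on both sides, but well-definedness of the
  estimator gives it only on the side of the kernel |x - y|^(2-p). In the scalar identity both
  measures are positive, so it is carried over by truncation. In the vector identity, taken
  coordinate by coordinate, the measures are signed; there the tail side differs from the scalar one
  by a factor t^2 \<le> 1 and is dominated by it. That factor is also the source of the two
  different powers of t: the completed square is centred at m / (l + m) times x, and the
  substitution is made so that m / (l + m) = t^2.\<close>

lemma integrable_mult_bounded_comp:
  fixes h :: "'a \<Rightarrow> real" and \<psi> :: "real \<Rightarrow> real"
  assumes h: "integrable N h" and [measurable]: "T \<in> borel_measurable N" "\<psi> \<in> borel_measurable borel"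
    and B: "\<And>x. \<bar>\<psi> (T x)\<bar> \<le> B"
  shows "integrable N (\<lambda>x. h x * \<psi> (T x))"
proof (rule Bochner_Integration.integrable_bound[OF integrable_mult_right[OF h, of B]])
  show "(\<lambda>x. h x * \<psi> (T x)) \<in> borel_measurable N"
    using h by measurable
  have "\<bar>\<psi> (T x)\<bar> \<le> \<bar>B\<bar>" for x using B[of x] by linarith
  then show "AE x in N. norm (h x * \<psi> (T x)) \<le> norm (B * h x)"
    by (auto simp: abs_mult mult.commute[of "\<bar>h x\<bar>" for x] intro!: mult_right_mono)
qed

lemma integral_mult_comp_LIMSEQ:
  fixes h :: "'a \<Rightarrow> real" and \<psi> :: "nat \<Rightarrow> real \<Rightarrow> real"
  assumes [measurable]: "h \<in> borel_measurable N" "T \<in> borel_measurable N"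
    "\<And>i. \<psi> i \<in> borel_measurable borel"
    and w: "integrable N (\<lambda>x. h x * w (T x))"
    and bd: "\<And>i v. \<bar>\<psi> i v\<bar> \<le> \<bar>w v\<bar>" and lim: "\<And>v. (\<lambda>i. \<psi> i v) \<longlonglongrightarrow> \<psi>' v"
  shows "(\<lambda>i. LINT x|N. h x * \<psi> i (T x)) \<longlonglongrightarrow> (LINT x|N. h x * \<psi>' (T x))"
proof (rule integral_dominated_convergence[where w="\<lambda>x. \<bar>h x * w (T x)\<bar>"])
  have [measurable]: "\<psi>' \<in> borel_measurable borel"
    by (rule borel_measurable_LIMSEQ_real[OF lim]) simp
  show "(\<lambda>x. h x * \<psi>' (T x)) \<in> borel_measurable N" by measurable
  show "(\<lambda>x. h x * \<psi> i (T x)) \<in> borel_measurable N" for i by measurable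
  show "integrable N (\<lambda>x. \<bar>h x * w (T x)\<bar>)" using w by (rule integrable_abs)
  show "AE x in N. (\<lambda>i. h x * \<psi> i (T x)) \<longlonglongrightarrow> h x * \<psi>' (T x)"
    by (intro AE_I2 tendsto_mult tendsto_const lim)
  show "AE x in N. norm (h x * \<psi> i (T x)) \<le> \<bar>h x * w (T x)\<bar>" for i
    unfolding real_norm_def abs_mult by (intro AE_I2 mult_left_mono bd abs_ge_zero)
qed

context
  fixes h1 :: "'a \<Rightarrow> real" and h2 :: "'b \<Rightarrow> real" and N1 N2 T1 T2
  assumes h1: "integrable N1 h1" and h2: "integrable N2 h2"
    and T1 [measurable]: "T1 \<in> borel_measurable N1" and T2 [measurable]: "T2 \<in> borel_measurable N2"
    and r1: "\<And>x. T1 x \<in> {0..1::real}" and r2: "\<And>x. T2 x \<in> {0..1::real}"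
    and moments: "\<And>n. (LINT x|N1. h1 x * T1 x ^ n) = (LINT x|N2. h2 x * T2 x ^ n)"
begin

text \<open>Weierstrass approximation on [0,1]: for a polynomial both integrals are the same
  combination of moments, and a uniform error \<open>e\<close> costs at most \<open>e\<close> times
  the integrals of |h1| and |h2|. The pair \<open>h1\<close>, \<open>T1\<close> stands for the
  signed measure on [0,1] that is the image under \<open>T1\<close> of \<open>N1\<close> with
  density \<open>h1\<close>.\<close>

lemma equal_moments_continuous:
  assumes \<phi>: "continuous_on UNIV \<phi>"
  shows "(LINT x|N1. h1 x * \<phi> (T1 x)) = (LINT x|N2. h2 x * \<phi> (T2 x))"
proof -
  have [measurable]: "\<phi> \<in> borel_measurable borel"
    using \<phi> by (rule borel_measurable_continuous_onI)
  have bdd: "\<exists>B. \<forall>v\<in>{0..1}. \<bar>\<psi> v\<bar> \<le> B" if "continuous_on UNIV \<psi>" for \<psi> :: "real \<Rightarrow> real"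
  proof -
    have "compact (\<psi> ` {0..1})"
      by (rule compact_continuous_image) (use that continuous_on_subset in auto)
    then obtain B where "\<forall>y\<in>\<psi> ` {0..1}. norm y \<le> B"
      using compact_imp_bounded bounded_iff by metis
    then show ?thesis by auto
  qed
  have int1: "integrable N1 (\<lambda>x. h1 x * \<psi> (T1 x))" and int2: "integrable N2 (\<lambda>x. h2 x * \<psi> (T2 x))"
    if \<psi>: "continuous_on UNIV \<psi>" for \<psi>
  proof -
    obtain B where B: "\<forall>v\<in>{0..1}. \<bar>\<psi> v\<bar> \<le> B" using bdd[OF \<psi>] by blast
    have [measurable]: "\<psi> \<in> borel_measurable borel"
      using \<psi> by (rule borel_measurable_continuous_onI)
    show "integrable N1 (\<lambda>x. h1 x * \<psi> (T1 x))"
      by (rule integrable_mult_bounded_comp[OF h1]) (use B r1 in auto)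
    show "integrable N2 (\<lambda>x. h2 x * \<psi> (T2 x))"
      by (rule integrable_mult_bounded_comp[OF h2]) (use B r2 in auto)
  qed
  define C where "C = (LINT x|N1. \<bar>h1 x\<bar>) + (LINT x|N2. \<bar>h2 x\<bar>)"
  have C0: "0 \<le> C" unfolding C_def by (intro add_nonneg_nonneg integral_nonneg_AE) auto
  define d where "d = \<bar>(LINT x|N1. h1 x * \<phi> (T1 x)) - (LINT x|N2. h2 x * \<phi> (T2 x))\<bar>"
  have small: "d \<le> e * C" if e: "e > 0" for e
  proof -
    obtain q where q: "real_polynomial_function q" "\<And>v. v \<in> {0..1} \<Longrightarrow> \<bar>\<phi> v - q v\<bar> < e"
      using Stone_Weierstrass_real_polynomial_function[of "{0..1::real}" \<phi> e] \<phi> e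
        continuous_on_subset by (metis compact_Icc subset_UNIV)
    have qc: "continuous_on UNIV q" using q(1)
      by (simp add: continuous_on_polymonial_function real_polynomial_function_eq)
    have [measurable]: "q \<in> borel_measurable borel"
      using qc by (rule borel_measurable_continuous_onI)
    from q(1) obtain a n where qa: "q = (\<lambda>x. \<Sum>i\<le>n. a i * x^i)"
      using real_polynomial_function_iff_sum by blast
    have "(LINT x|N1. h1 x * q (T1 x)) = (\<Sum>i\<le>n. a i * (LINT x|N1. h1 x * T1 x ^ i))"
    proof -
      have "(LINT x|N1. h1 x * q (T1 x)) = (LINT x|N1. (\<Sum>i\<le>n. a i * (h1 x * T1 x ^ i)))"
        by (simp add: qa sum_distrib_left mult_ac)
      also have "\<dots> = (\<Sum>i\<le>n. (LINT x|N1. a i * (h1 x * T1 x ^ i)))"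
        by (intro Bochner_Integration.integral_sum integrable_mult_right int1) (intro continuous_intros)
      finally show ?thesis by simp
    qed
    also have "\<dots> = (\<Sum>i\<le>n. a i * (LINT x|N2. h2 x * T2 x ^ i))" by (simp add: moments)
    also have "\<dots> = (LINT x|N2. h2 x * q (T2 x))"
    proof -
      have "(LINT x|N2. h2 x * q (T2 x)) = (LINT x|N2. (\<Sum>i\<le>n. a i * (h2 x * T2 x ^ i)))"
        by (simp add: qa sum_distrib_left mult_ac)
      also have "\<dots> = (\<Sum>i\<le>n. (LINT x|N2. a i * (h2 x * T2 x ^ i)))"
        by (intro Bochner_Integration.integral_sum integrable_mult_right int2) (intro continuous_intros)
      finally show ?thesis by simp
    qed
    finally have eq: "(LINT x|N1. h1 x * q (T1 x)) = (LINT x|N2. h2 x * q (T2 x))" .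
    have "\<bar>(LINT x|N1. h1 x * \<phi> (T1 x)) - (LINT x|N1. h1 x * q (T1 x))\<bar> \<le> e * (LINT x|N1. \<bar>h1 x\<bar>)"
    proof -
      have "\<bar>h1 x * \<phi> (T1 x) - h1 x * q (T1 x)\<bar> \<le> e * \<bar>h1 x\<bar>" for x
        using mult_left_mono[OF less_imp_le[OF q(2)[OF r1[of x]]], of "\<bar>h1 x\<bar>"]
        by (simp add: abs_mult[symmetric] algebra_simps)
      then have "\<bar>LINT x|N1. h1 x * \<phi> (T1 x) - h1 x * q (T1 x)\<bar> \<le> (LINT x|N1. e * \<bar>h1 x\<bar>)"
        using h1 int1[OF \<phi>] int1[OF qc]
        by (intro order_trans[OF integral_abs_bound] integral_mono) auto
      then show ?thesis using int1[OF \<phi>] int1[OF qc] by simp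
    qed
    moreover have "\<bar>(LINT x|N2. h2 x * \<phi> (T2 x)) - (LINT x|N2. h2 x * q (T2 x))\<bar> \<le> e * (LINT x|N2. \<bar>h2 x\<bar>)"
    proof -
      have "\<bar>h2 x * \<phi> (T2 x) - h2 x * q (T2 x)\<bar> \<le> e * \<bar>h2 x\<bar>" for x
        using mult_left_mono[OF less_imp_le[OF q(2)[OF r2[of x]]], of "\<bar>h2 x\<bar>"]
        by (simp add: abs_mult[symmetric] algebra_simps)
      then have "\<bar>LINT x|N2. h2 x * \<phi> (T2 x) - h2 x * q (T2 x)\<bar> \<le> (LINT x|N2. e * \<bar>h2 x\<bar>)"
        using h2 int2[OF \<phi>] int2[OF qc]
        by (intro order_trans[OF integral_abs_bound] integral_mono) auto
      then show ?thesis using int2[OF \<phi>] int2[OF qc] by simp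
    qed
    ultimately show ?thesis using eq unfolding d_def C_def by (simp add: algebra_simps)
  qed
  have "d \<le> 0"
  proof (rule field_le_epsilon)
    fix e :: real assume "0 < e"
    \<comment> \<open>Dividing by \<open>C + 1\<close> covers the case \<open>C = 0\<close>.\<close>
    then have "d \<le> e / (C + 1) * C" using C0 by (intro small) simp
    also have "\<dots> \<le> e" using C0 \<open>0 < e\<close> by (simp add: field_simps)
    finally show "d \<le> 0 + e" by simp
  qed
  then show ?thesis unfolding d_def by simp
qed

private lemma integrable_indicator:
  assumes "B \<in> sets borel"
  shows "integrable N1 (\<lambda>x. h1 x * indicator B (T1 x))" "integrable N2 (\<lambda>x. h2 x * indicator B (T2 x))"
  by (rule integrable_mult_bounded_comp[where B=1, OF h1] integrable_mult_bounded_comp[where B=1, OF h2];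
      use assms in \<open>auto simp: indicator_def\<close>)+

text \<open>The sets on which two signed measures of equal total mass agree form a Dynkin system,
  and the half-lines \<open>{..a}\<close> are an intersection-stable generator. Since the masses are
  signed, limits are taken by dominated convergence, with |h1| and |h2| as bounds.\<close>

lemma equal_moments_indicator:
  assumes A: "A \<in> sets borel"
  shows "(LINT x|N1. h1 x * indicator A (T1 x)) = (LINT x|N2. h2 x * indicator A (T2 x))"
proof -
  \<comment> \<open>The moment of order 0 gives equal total mass, which the complement case
    needs.\<close>
  have total: "(LINT x|N1. h1 x) = (LINT x|N2. h2 x)" using moments[of 0] by simp
  have "A \<in> sigma_sets UNIV (range (\<lambda>a::real. {..a}))"
    using A by (simp add: borel_eq_atMost)
  then show ?thesis
  proof (induction rule: sigma_sets_induct_disjoint[rotated 2, consumes 1, case_names basic empty compl union Int sub])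
    case Int
    show ?case by (auto simp: Int_stable_def)
  next
    case sub
    show ?case by auto
  next
    case (basic B)
    then obtain a where B: "B = {..a}" by auto
    \<comment> \<open>A ramp falling from 1 at \<open>a\<close> to 0 at \<open>a + 1/k\<close>:
      continuous functions decreasing to the indicator of the half-line.\<close>
    define \<phi> where "\<phi> k v = max 0 (min 1 (1 - real k * (v - a)))" for k :: nat and v
    have c: "continuous_on UNIV (\<phi> k)" for k
      unfolding \<phi>_def by (intro continuous_intros)
    have [measurable]: "\<phi> k \<in> borel_measurable borel" for k
      using c by (rule borel_measurable_continuous_onI)
    have b: "\<bar>\<phi> k v\<bar> \<le> 1" for k v by (auto simp: \<phi>_def)
    have lim: "(\<lambda>k. \<phi> k v) \<longlonglongrightarrow> indicator B v" for v
    proof (cases "v \<le> a")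
      case True
      then have "\<phi> k v = 1" for k by (simp add: \<phi>_def mult_nonneg_nonpos)
      then show ?thesis using True B by simp
    next
      case False
      then obtain m :: nat where m: "1 / (v - a) < real m" using reals_Archimedean2 by blast
      have "eventually (\<lambda>k. \<phi> k v = 0) sequentially"
        using eventually_ge_at_top[of m]
      proof eventually_elim
        case (elim k)
        have "1 < real m * (v - a)" using m False by (simp add: field_simps)
        also have "\<dots> \<le> real k * (v - a)" using elim False by (intro mult_right_mono) auto
        finally show ?case by (simp add: \<phi>_def)
      qed
      then show ?thesis using False B by (simp add: tendsto_eventually)
    qed
    have Bm [measurable]: "B \<in> sets borel" by (simp add: B)
    have "(\<lambda>k. LINT x|N1. h1 x * \<phi> k (T1 x)) \<longlonglongrightarrow> (LINT x|N1. h1 x * indicator B (T1 x))"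
      by (rule integral_mult_comp_LIMSEQ[where w="\<lambda>_. 1"]) (use h1 b lim in simp_all)
    moreover have "(\<lambda>k. LINT x|N2. h2 x * \<phi> k (T2 x)) \<longlonglongrightarrow> (LINT x|N2. h2 x * indicator B (T2 x))"
      by (rule integral_mult_comp_LIMSEQ[where w="\<lambda>_. 1"]) (use h2 b lim in simp_all)
    ultimately show ?case
      using equal_moments_continuous[OF c] LIMSEQ_unique by simp
  next
    case empty
    show ?case by simp
  next
    case (compl B)
    then have B: "B \<in> sets borel" by (simp add: borel_eq_atMost)
    have ind: "y * indicator (UNIV - B) v = y - y * indicator B v" for y v :: real
      by (simp add: indicator_def)
    show ?case
      unfolding ind using compl integrable_indicator(1)[OF B] integrable_indicator(2)[OF B] h1 h2 total by simp
  next
    case (union D)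
    then have D: "D i \<in> sets borel" for i by (auto simp: borel_eq_atMost)
    have fin: "y * indicator (\<Union>i<n. D i) v = (\<Sum>i<n. y * indicator (D i) v)" for y v :: real and n
      using union(1) by (subst indicator_UN_disjoint)
        (auto simp: sum_distrib_left disjoint_family_on_def)
    have D': "(\<Union>i<n. D i) \<in> sets borel" for n using D by blast
    have partial: "(LINT x|N1. h1 x * indicator (\<Union>i<n. D i) (T1 x)) = (LINT x|N2. h2 x * indicator (\<Union>i<n. D i) (T2 x))" for n
    proof -
      have "(LINT x|N1. h1 x * indicator (\<Union>i<n. D i) (T1 x)) = (\<Sum>i<n. LINT x|N1. h1 x * indicator (D i) (T1 x))"
        unfolding fin using integrable_indicator(1)[OF D] by (rule Bochner_Integration.integral_sum)
      also have "\<dots> = (\<Sum>i<n. LINT x|N2. h2 x * indicator (D i) (T2 x))"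
        using union(3) by simp
      also have "\<dots> = (LINT x|N2. h2 x * indicator (\<Union>i<n. D i) (T2 x))"
        unfolding fin using integrable_indicator(2)[OF D] by (rule Bochner_Integration.integral_sum[symmetric])
      finally show ?thesis .
    qed
    have "(\<lambda>n. LINT x|N1. h1 x * indicator (\<Union>i<n. D i) (T1 x)) \<longlonglongrightarrow> (LINT x|N1. h1 x * indicator (\<Union>i. D i) (T1 x))"
      by (rule integral_mult_comp_LIMSEQ[where w="\<lambda>_. 1"])
        (use h1 D' LIMSEQ_indicator_UN in \<open>simp_all add: abs_indicator indicator_le_1\<close>)
    moreover have "(\<lambda>n. LINT x|N2. h2 x * indicator (\<Union>i<n. D i) (T2 x)) \<longlonglongrightarrow> (LINT x|N2. h2 x * indicator (\<Union>i. D i) (T2 x))"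
      by (rule integral_mult_comp_LIMSEQ[where w="\<lambda>_. 1"])
        (use h2 D' LIMSEQ_indicator_UN in \<open>simp_all add: abs_indicator indicator_le_1\<close>)
    ultimately show ?case
      using partial LIMSEQ_unique by simp
  qed
qed

text \<open>Simple functions reduce this to indicators. As \<open>g\<close> may be unbounded, the
  approximating functions are taken with absolute value at most 2 * |g|, and \<open>i1\<close> and
  \<open>i2\<close> supply the dominating functions.\<close>

lemma equal_moments_borel:
  assumes g [measurable]: "g \<in> borel_measurable borel"
    and i1: "integrable N1 (\<lambda>x. h1 x * g (T1 x))" and i2: "integrable N2 (\<lambda>x. h2 x * g (T2 x))"
  shows "(LINT x|N1. h1 x * g (T1 x)) = (LINT x|N2. h2 x * g (T2 x))"
proof -
  from borel_measurable_implies_sequence_metric[OF g, of 0] obtain F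
    where "\<forall>i. simple_function borel (F i)" "\<forall>v\<in>space borel. (\<lambda>i. F i v) \<longlonglongrightarrow> g v"
      "\<forall>i. \<forall>v\<in>space borel. dist (F i v) 0 \<le> 2 * dist (g v) 0"
    by (elim exE conjE)
  then have F: "\<And>i. simple_function borel (F i)" "\<And>v. (\<lambda>i. F i v) \<longlonglongrightarrow> g v"
    "\<And>i v. \<bar>F i v\<bar> \<le> 2 * \<bar>g v\<bar>"
    by (simp_all add: dist_norm)
  have Fm [measurable]: "F i \<in> borel_measurable borel" for i
    using F(1) by (rule borel_measurable_simple_function)
  have A: "F i -` {y} \<in> sets borel" for i y
    using measurable_sets[OF Fm[of i], of "{y}"] by simp
  have rep: "a * F i v = (\<Sum>y\<in>range (F i). y * (a * indicator (F i -` {y}) v))" for a :: real and i v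
  proof -
    have "F i v = (\<Sum>y\<in>range (F i). indicator (F i -` {y}) v *\<^sub>R y)"
      using simple_function_indicator_representation_banach[OF F(1), unfolded space_borel Int_UNIV_right, OF UNIV_I] .
    then have "a * F i v = (\<Sum>y\<in>range (F i). a * (indicator (F i -` {y}) v *\<^sub>R y))"
      by (metis sum_distrib_left)
    also have "\<dots> = (\<Sum>y\<in>range (F i). y * (a * indicator (F i -` {y}) v))"
      by (intro sum.cong refl) simp
    finally show ?thesis .
  qed
  have eq: "(LINT x|N1. h1 x * F i (T1 x)) = (LINT x|N2. h2 x * F i (T2 x))" for i
  proof -
    have "(LINT x|N1. h1 x * F i (T1 x)) = (\<Sum>y\<in>range (F i). y * (LINT x|N1. h1 x * indicator (F i -` {y}) (T1 x)))"
      unfolding rep by (subst Bochner_Integration.integral_sum) (intro integrable_mult_right integrable_indicator(1) A, rule sum.cong[OF refl], simp)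
    also have "\<dots> = (\<Sum>y\<in>range (F i). y * (LINT x|N2. h2 x * indicator (F i -` {y}) (T2 x)))"
      by (simp only: equal_moments_indicator[OF A])
    also have "\<dots> = (LINT x|N2. h2 x * F i (T2 x))"
      unfolding rep by (subst Bochner_Integration.integral_sum) (intro integrable_mult_right integrable_indicator(2) A, rule sum.cong[OF refl], simp)
    finally show ?thesis .
  qed
  note [measurable] = borel_measurable_integrable[OF h1] borel_measurable_integrable[OF h2]
  have "(\<lambda>i. LINT x|N1. h1 x * F i (T1 x)) \<longlonglongrightarrow> (LINT x|N1. h1 x * g (T1 x))"
  proof (rule integral_mult_comp_LIMSEQ[where w="\<lambda>v. 2 * g v" and h=h1 and T=T1 and \<psi>=F and \<psi>'=g])
    show "integrable N1 (\<lambda>x. h1 x * (2 * g (T1 x)))"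
      using integrable_mult_right[OF assms(2), of 2] by (simp add: mult.left_commute)
    show "\<bar>F i v\<bar> \<le> \<bar>2 * g v\<bar>" for i v using F(3)[of i v] by simp
    show "(\<lambda>i. F i v) \<longlonglongrightarrow> g v" for v by (rule F(2))
  qed measurable
  moreover have "(\<lambda>i. LINT x|N2. h2 x * F i (T2 x)) \<longlonglongrightarrow> (LINT x|N2. h2 x * g (T2 x))"
  proof (rule integral_mult_comp_LIMSEQ[where w="\<lambda>v. 2 * g v" and h=h2 and T=T2 and \<psi>=F and \<psi>'=g])
    show "integrable N2 (\<lambda>x. h2 x * (2 * g (T2 x)))"
      using integrable_mult_right[OF assms(3), of 2] by (simp add: mult.left_commute)
    show "\<bar>F i v\<bar> \<le> \<bar>2 * g v\<bar>" for i v using F(3)[of i v] by simp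
    show "(\<lambda>i. F i v) \<longlonglongrightarrow> g v" for v by (rule F(2))
  qed measurable
  ultimately show ?thesis
    using eq LIMSEQ_unique by simp
qed

end

section \<open>From moments on [0,1] to Gaussian integrals on the half-line\<close>

context
  fixes k1 :: "'a \<Rightarrow> real" and k2 :: "'b \<Rightarrow> real" and N1 N2 S1 S2
  assumes S1 [measurable]: "S1 \<in> borel_measurable N1" and S2 [measurable]: "S2 \<in> borel_measurable N2"
    and pos1: "\<And>x. S1 x \<ge> (0::real)" and pos2: "\<And>x. S2 x \<ge> (0::real)"
    and int1: "integrable N1 (\<lambda>x. k1 x * exp (- (S1 x)\<^sup>2))"
    and int2: "integrable N2 (\<lambda>x. k2 x * exp (- (S2 x)\<^sup>2))"
    and gauss: "\<And>c. c \<ge> 1 \<Longrightarrow>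
      (LINT x|N1. k1 x * exp (- c * (S1 x)\<^sup>2)) = (LINT x|N2. k2 x * exp (- c * (S2 x)\<^sup>2))"
begin

lemma equal_gaussian_integrals:
  assumes g [measurable]: "g \<in> borel_measurable borel"
    and i1: "integrable N1 (\<lambda>x. k1 x * g (S1 x))" and i2: "integrable N2 (\<lambda>x. k2 x * g (S2 x))"
  shows "(LINT x|N1. k1 x * g (S1 x)) = (LINT x|N2. k2 x * g (S2 x))"
proof -
  \<comment> \<open>\<open>G\<close> is \<open>g\<close> read in the variable v = exp(-s^2): for s
    \<ge> 0 one has s = sqrt(-ln v), and the division by \<open>v\<close> undoes the Gaussian weight
    attached to \<open>k1\<close> and \<open>k2\<close>.\<close>
  define G where "G v = g (sqrt (- ln v)) / v" for v
  have [measurable]: "G \<in> borel_measurable borel" unfolding G_def by measurable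
  have G: "a * g s = (a * exp (- s\<^sup>2)) * G (exp (- s\<^sup>2))" if "s \<ge> 0" for a s
    using that by (simp add: G_def)
  \<comment> \<open>The weight contributes one Gaussian of its own, so the n-th moment has parameter
    n + 1, within the range c \<ge> 1 of \<open>gauss\<close>.\<close>
  have pw: "a * exp (- s\<^sup>2) * exp (- s\<^sup>2) ^ n = a * exp (- (real n + 1) * s\<^sup>2)" for a s :: real and n
  proof -
    have "- (real n + 1) * s\<^sup>2 = - s\<^sup>2 + real n * (- s\<^sup>2)" by (simp add: algebra_simps)
    then have "exp (- (real n + 1) * s\<^sup>2) = exp (- s\<^sup>2) * exp (- s\<^sup>2) ^ n"
      by (metis exp_add exp_of_nat_mult)
    then show ?thesis by (metis mult.assoc)
  qed
  show ?thesis
    unfolding G[OF pos1] G[OF pos2]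
  proof (rule equal_moments_borel[where g=G and ?h1.0="\<lambda>x. k1 x * exp (- (S1 x)\<^sup>2)"
        and ?h2.0="\<lambda>x. k2 x * exp (- (S2 x)\<^sup>2)" and ?T1.0="\<lambda>x. exp (- (S1 x)\<^sup>2)" and ?T2.0="\<lambda>x. exp (- (S2 x)\<^sup>2)"])
    show "(LINT x|N1. k1 x * exp (- (S1 x)\<^sup>2) * exp (- (S1 x)\<^sup>2) ^ n) =
        (LINT x|N2. k2 x * exp (- (S2 x)\<^sup>2) * exp (- (S2 x)\<^sup>2) ^ n)" for n
      unfolding pw by (rule gauss) simp
    show "integrable N1 (\<lambda>x. k1 x * exp (- (S1 x)\<^sup>2) * G (exp (- (S1 x)\<^sup>2)))"
      using i1 unfolding G[OF pos1] .
    show "integrable N2 (\<lambda>x. k2 x * exp (- (S2 x)\<^sup>2) * G (exp (- (S2 x)\<^sup>2)))"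
      using i2 unfolding G[OF pos2] .
    show "exp (- (S1 x)\<^sup>2) \<in> {0..1}" for x by simp
    show "exp (- (S2 x)\<^sup>2) \<in> {0..1}" for x by simp
    show "(\<lambda>x. exp (- (S1 x)\<^sup>2)) \<in> borel_measurable N1" by measurable
    show "(\<lambda>x. exp (- (S2 x)\<^sup>2)) \<in> borel_measurable N2" by measurable
  qed (fact int1 int2 \<open>G \<in> borel_measurable borel\<close>)+
qed

text \<open>Truncations of \<open>g\<close> are integrable on both sides and have equal integrals
  there. On the \<open>N1\<close> side these converge to the integral of \<open>g\<close>, so on the
  \<open>N2\<close> side they stay bounded and monotone convergence yields integrability of the
  limit.\<close>

lemma equal_gaussian_integrals_nonneg:
  assumes g [measurable]: "g \<in> borel_measurable borel"
    and k1: "\<And>x. k1 x \<ge> 0" and k2: "\<And>x. k2 x \<ge> 0" and g_nonneg: "\<And>s. g s \<ge> 0"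
    and k2_meas [measurable]: "k2 \<in> borel_measurable N2"
    and i1: "integrable N1 (\<lambda>x. k1 x * g (S1 x))"
  shows "integrable N2 (\<lambda>x. k2 x * g (S2 x))"
proof -
  \<comment> \<open>The cap is a multiple of a Gaussian and not a constant because the measures may
    have infinite mass; \<open>int1\<close> and \<open>int2\<close> control exactly this
    cap.\<close>
  define gn where "gn n s = min (g s) (real n * exp (- s\<^sup>2))" for n s
  have [measurable]: "gn n \<in> borel_measurable borel" for n unfolding gn_def by measurable
  have gn0: "0 \<le> gn n s" and gn1: "gn n s \<le> g s" and gn2: "gn n s \<le> real n * exp (- s\<^sup>2)" for n s
    using g_nonneg[of s] by (auto simp: gn_def)
  have lim: "(\<lambda>n. gn n s) \<longlonglongrightarrow> g s" for s
  proof -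
    obtain m :: nat where m: "g s / exp (- s\<^sup>2) < real m" using reals_Archimedean2 by blast
    have "eventually (\<lambda>n. gn n s = g s) sequentially"
      using eventually_ge_at_top[of m]
    proof eventually_elim
      case (elim n)
      have "g s \<le> real m * exp (- s\<^sup>2)" using m by (simp add: pos_divide_less_eq)
      also have "\<dots> \<le> real n * exp (- s\<^sup>2)" using elim by simp
      finally show ?case by (simp add: gn_def)
    qed
    then show ?thesis by (rule tendsto_eventually)
  qed
  \<comment> \<open>Measurability is drawn from \<open>int1\<close> by multiplying and dividing by
    the Gaussian, which never vanishes.\<close>
  have m1: "(\<lambda>x. k1 x * gn n (S1 x)) \<in> borel_measurable N1" for n
  proof -
    have "(\<lambda>x. (k1 x * exp (- (S1 x)\<^sup>2)) * (gn n (S1 x) / exp (- (S1 x)\<^sup>2))) \<in> borel_measurable N1"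
      by (rule borel_measurable_times[OF borel_measurable_integrable[OF int1]]) measurable
    then show ?thesis by simp
  qed
  have ia: "integrable N1 (\<lambda>x. k1 x * gn n (S1 x))" for n
    by (rule Bochner_Integration.integrable_bound[OF i1 m1])
      (use k1 gn0 gn1 g_nonneg in \<open>auto intro!: mult_left_mono\<close>)
  have ib: "integrable N2 (\<lambda>x. k2 x * gn n (S2 x))" for n
  proof (rule Bochner_Integration.integrable_bound[OF integrable_mult_right[OF int2, of "real n"]])
    show "AE x in N2. norm (k2 x * gn n (S2 x)) \<le> norm (real n * (k2 x * exp (- (S2 x)\<^sup>2)))"
    proof (rule AE_I2)
      fix x
      have "k2 x * gn n (S2 x) \<le> k2 x * (real n * exp (- (S2 x)\<^sup>2))"
        using gn2 k2 by (rule mult_left_mono)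
      then show "norm (k2 x * gn n (S2 x)) \<le> norm (real n * (k2 x * exp (- (S2 x)\<^sup>2)))"
        using k2[of x] gn0[of n "S2 x"] by (simp add: mult.left_commute)
    qed
  qed measurable
  have conv: "(\<lambda>n. LINT x|N2. k2 x * gn n (S2 x)) \<longlonglongrightarrow> (LINT x|N1. k1 x * g (S1 x))"
  proof -
    have "(\<lambda>n. LINT x|N1. k1 x * gn n (S1 x)) \<longlonglongrightarrow> (LINT x|N1. k1 x * g (S1 x))"
      by (rule integral_dominated_convergence[OF borel_measurable_integrable[OF i1] m1 i1])
        (use k1 gn0 gn1 lim g_nonneg in \<open>auto intro!: mult_left_mono tendsto_mult\<close>)
    moreover have "(LINT x|N1. k1 x * gn n (S1 x)) = (LINT x|N2. k2 x * gn n (S2 x))" for n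
      by (rule equal_gaussian_integrals) (use ia ib in auto)
    ultimately show ?thesis by simp
  qed
  show ?thesis
  proof (rule integrable_monotone_convergence[OF ib _ _ conv])
    show "AE x in N2. mono (\<lambda>n. k2 x * gn n (S2 x))"
      unfolding gn_def using k2
      by (intro AE_I2 monoI mult_left_mono min.mono order.refl mult_right_mono) auto
    show "AE x in N2. (\<lambda>n. k2 x * gn n (S2 x)) \<longlonglongrightarrow> k2 x * g (S2 x)"
      using lim by (intro AE_I2 tendsto_mult) auto
  qed measurable
qed

end

subsection \<open>Gaussian integrals\<close>

lemma has_bochner_integral_gaussian_real:
  assumes a: "a > (0::real)"
  shows "has_bochner_integral lborel (\<lambda>x. exp (- a * x\<^sup>2)) (sqrt (pi / a))"
proof -
  define s where "s = sqrt (1 / (2 * a))"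
  have s: "s > 0" "s\<^sup>2 = 1 / (2 * a)" using a by (simp_all add: s_def)
  have eq: "exp (- a * x\<^sup>2) = sqrt (pi / a) * normal_density 0 s x" for x
  proof -
    have "2 * pi * s\<^sup>2 = pi / a" using a s by (simp add: field_simps)
    moreover have "- (x - 0)\<^sup>2 / (2 * s\<^sup>2) = - a * x\<^sup>2" using a s by (simp add: field_simps)
    moreover have "sqrt (pi / a) > 0" using a by simp
    ultimately show ?thesis using a unfolding normal_density_def by simp
  qed
  show ?thesis
    unfolding eq using has_bochner_integral_mult_right[of "sqrt (pi / a)" lborel "normal_density 0 s" 1] s
    by (simp add: has_bochner_integral_iff)
qed

lemma has_bochner_integral_gaussian:
  assumes a: "a > 0"
  shows "has_bochner_integral lborel (\<lambda>y::'a::euclidean_space. exp (- a * (norm y)\<^sup>2)) (sqrt (pi / a) ^ DIM('a))"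
proof (rule has_bochner_integral_nn_integral)
  have "(\<integral>\<^sup>+ y. ennreal (exp (- a * (norm y)\<^sup>2)) \<partial>(lborel :: 'a measure)) =
      (\<integral>\<^sup>+ y. (\<Prod>b\<in>Basis. ennreal (exp (- a * (y \<bullet> b)\<^sup>2))) \<partial>(lborel :: 'a measure))"
  proof (rule nn_integral_cong)
    fix y :: 'a
    have "- a * (norm y)\<^sup>2 = (\<Sum>b\<in>Basis. - a * (y \<bullet> b)\<^sup>2)"
      unfolding sum_distrib_left[symmetric] power2_norm_eq_inner
      by (simp only: euclidean_inner[of y y] power2_eq_square)
    then show "ennreal (exp (- a * (norm y)\<^sup>2)) = (\<Prod>b\<in>Basis. ennreal (exp (- a * (y \<bullet> b)\<^sup>2)))"
      by (simp add: exp_sum prod_ennreal)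
  qed
  also have "\<dots> = (\<Prod>b\<in>(Basis::'a set). (\<integral>\<^sup>+ x. ennreal (exp (- a * x\<^sup>2)) \<partial>lborel))"
    by (rule nn_integral_lborel_prod) auto
  also have "(\<integral>\<^sup>+ x. ennreal (exp (- a * x\<^sup>2)) \<partial>lborel) = ennreal (sqrt (pi / a))"
    using has_bochner_integral_gaussian_real[OF a]
    by (subst nn_integral_eq_integral) (auto simp: has_bochner_integral_iff)
  finally show "(\<integral>\<^sup>+ y. ennreal (exp (- a * (norm (y::'a))\<^sup>2)) \<partial>lborel) = ennreal (sqrt (pi / a) ^ DIM('a))"
    using a by (simp add: ennreal_power)
qed (use a in auto)

text \<open>From 2ab \<le> a^2 + b^2 and 1 + z \<le> exp z. It lets half of a Gaussian exponent
  absorb a linear factor.\<close>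

lemma norm_le_exp:
  assumes a: "a > 0"
  shows "norm (y::'a::real_normed_vector) \<le> exp (a / 2 * (norm y)\<^sup>2) / sqrt a"
proof -
  have "norm y * sqrt a \<le> 1 + a / 2 * (norm y)\<^sup>2"
    using sum_squares_bound[of "norm y * sqrt a" 1] a
    by (simp add: power_mult_distrib mult.commute[of a])
  also have "\<dots> \<le> exp (a / 2 * (norm y)\<^sup>2)" by (rule exp_ge_add_one_self)
  finally show ?thesis using a by (simp add: field_simps)
qed

lemma lborel_distr_reflect: "distr lborel borel (\<lambda>y. t - y) = (lborel :: 'a::euclidean_space measure)"
  using lborel_affine[of "-1::real" t] by (simp add: density_1)

lemma integrable_lborel_reflect:
  fixes f :: "'a::euclidean_space \<Rightarrow> 'b::{banach, second_countable_topology}"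
  assumes "integrable lborel f"
  shows "integrable lborel (\<lambda>y. f (t - y))"
  using assms integrable_distr[of "\<lambda>y. t - y" lborel borel f] by (simp add: lborel_distr_reflect)

lemma integral_lborel_reflect:
  fixes f :: "'a::euclidean_space \<Rightarrow> 'b::{banach, second_countable_topology}"
  assumes "f \<in> borel_measurable borel"
  shows "(LINT y|lborel. f (t - y)) = (LINT y|lborel. f y)"
  using assms integral_distr[of "\<lambda>y. t - y" lborel borel f] by (simp add: lborel_distr_reflect)

lemma inner_gaussian_bound:
  fixes y b :: "'a::real_inner"
  assumes a: "a > 0"
  shows "\<bar>y \<bullet> b\<bar> * exp (- a * (norm y)\<^sup>2) \<le> norm b / sqrt a * exp (- (a / 2) * (norm y)\<^sup>2)"
proof -
  have "\<bar>y \<bullet> b\<bar> \<le> norm y * norm b" by (rule Cauchy_Schwarz_ineq2)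
  also have "\<dots> \<le> exp (a / 2 * (norm y)\<^sup>2) / sqrt a * norm b"
    by (intro mult_right_mono norm_le_exp a) simp
  finally have "\<bar>y \<bullet> b\<bar> * exp (- a * (norm y)\<^sup>2) \<le> exp (a / 2 * (norm y)\<^sup>2) / sqrt a * norm b * exp (- a * (norm y)\<^sup>2)"
    by (rule mult_right_mono) simp
  also have "\<dots> = norm b / sqrt a * (exp (a / 2 * (norm y)\<^sup>2) * exp (- a * (norm y)\<^sup>2))" by simp
  also have "exp (a / 2 * (norm y)\<^sup>2) * exp (- a * (norm y)\<^sup>2) = exp (- (a / 2) * (norm y)\<^sup>2)"
    by (simp add: exp_add[symmetric] field_simps)
  finally show ?thesis .
qed

text \<open>The integrand is odd, so reflection at the origin shows that its integral equals its own
  negative.\<close>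

lemma has_bochner_integral_inner_gaussian:
  fixes b :: "'a::euclidean_space"
  assumes a: "a > 0"
  shows "has_bochner_integral lborel (\<lambda>y. (y \<bullet> b) * exp (- a * (norm y)\<^sup>2)) 0"
proof -
  have "integrable lborel (\<lambda>y. (y \<bullet> b) * exp (- a * (norm y)\<^sup>2))"
  proof (rule Bochner_Integration.integrable_bound)
    show "integrable lborel (\<lambda>y::'a. norm b / sqrt a * exp (- (a / 2) * (norm y)\<^sup>2))"
      using has_bochner_integral_gaussian[of "a / 2", where 'a='a] a
      by (intro integrable_mult_right) (auto simp: has_bochner_integral_iff)
    show "AE y in lborel. norm ((y \<bullet> b) * exp (- a * (norm y)\<^sup>2)) \<le> norm (norm b / sqrt a * exp (- (a / 2) * (norm y)\<^sup>2))"
      using inner_gaussian_bound[OF a, of _ b] a by (simp add: abs_mult)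
  qed auto
  moreover have "(LINT y|lborel. (y \<bullet> b) * exp (- a * (norm y)\<^sup>2)) = - (LINT y|lborel. (y \<bullet> b) * exp (- a * (norm y)\<^sup>2))"
    using integral_lborel_reflect[of "\<lambda>y. (y \<bullet> b) * exp (- a * (norm y)\<^sup>2)" 0] by simp
  ultimately show ?thesis by (simp add: has_bochner_integral_iff)
qed

lemma has_bochner_integral_lborel_shift:
  fixes f :: "'a::euclidean_space \<Rightarrow> 'b::{banach, second_countable_topology}"
  assumes "has_bochner_integral lborel f i"
  shows "has_bochner_integral lborel (\<lambda>y. f (y - c)) i"
proof -
  have m: "f \<in> borel_measurable borel"
    using borel_measurable_has_bochner_integral[OF assms] by simp
  have "has_bochner_integral (distr lborel borel ((+) (- c))) f i"
    unfolding lborel_distr_plus by (rule assms)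
  then show ?thesis
    using m unfolding has_bochner_integral_iff
    by (subst (asm) integrable_distr_eq, simp, simp, subst (asm) integral_distr, simp, simp) (simp add: add.commute[of "- c"])
qed

section \<open>Completing the square: products of two Gaussians\<close>

lemma complete_square:
  fixes x y :: "'a::real_inner"
  assumes "l + m > 0"
  shows "- l * (norm y)\<^sup>2 - m * (norm (x - y))\<^sup>2 =
    - (l * m / (l + m)) * (norm x)\<^sup>2 - (l + m) * (norm (y - (m / (l + m)) *\<^sub>R x))\<^sup>2"
proof -
  define q where "q = m / (l + m)"
  have q: "(l + m) * q = m" using assms by (simp add: q_def)
  have c: "l * m / (l + m) = m - m * q"
    using assms by (simp add: q_def field_simps)
  have N: "(norm (y - q *\<^sub>R x))\<^sup>2 = (norm y)\<^sup>2 - 2 * q * (x \<bullet> y) + q\<^sup>2 * (norm x)\<^sup>2"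
    unfolding power2_norm_eq_inner
    by (simp add: inner_diff_left inner_diff_right inner_commute power2_eq_square)
  have "(l + m) * (norm (y - q *\<^sub>R x))\<^sup>2 =
      (l + m) * (norm y)\<^sup>2 - 2 * ((l + m) * q) * (x \<bullet> y) + ((l + m) * q) * q * (norm x)\<^sup>2"
    unfolding N by (simp add: algebra_simps power2_eq_square)
  then have "(l + m) * (norm (y - q *\<^sub>R x))\<^sup>2 =
      (l + m) * (norm y)\<^sup>2 - 2 * m * (x \<bullet> y) + m * q * (norm x)\<^sup>2"
    unfolding q .
  moreover have D: "(norm (x - y))\<^sup>2 = (norm x)\<^sup>2 - 2 * (x \<bullet> y) + (norm y)\<^sup>2"
    unfolding power2_norm_eq_inner by (simp add: inner_diff_left inner_diff_right inner_commute)
  ultimately show ?thesis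
    unfolding c q_def[symmetric] D by (simp add: algebra_simps)
qed

context
  fixes x :: "'a::euclidean_space" and l m :: real
  assumes lm: "l + m > 0"
begin

lemma exp_complete_square:
  "exp (- l * (norm y)\<^sup>2 - m * (norm (x - y))\<^sup>2) =
    exp (- (l * m / (l + m)) * (norm x)\<^sup>2) * exp (- (l + m) * (norm (y - (m / (l + m)) *\<^sub>R x))\<^sup>2)"
  unfolding complete_square[OF lm] exp_add[symmetric]
  unfolding mult_minus_left diff_conv_add_uminus ..

lemma has_bochner_integral_two_gaussians:
  "has_bochner_integral lborel (\<lambda>y. exp (- l * (norm y)\<^sup>2 - m * (norm (x - y))\<^sup>2))
     (exp (- (l * m / (l + m)) * (norm x)\<^sup>2) * sqrt (pi / (l + m)) ^ DIM('a))"
  unfolding exp_complete_square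
  using has_bochner_integral_lborel_shift[OF has_bochner_integral_gaussian[OF lm]]
  by (rule has_bochner_integral_mult_right)

text \<open>Write \<open>y\<close> as deviation from the centre m / (l + m) times \<open>x\<close>,
  plus that centre: the deviation integrates to 0 by oddness, and the centre is a constant factor in
  front of the Gaussian mass.\<close>

lemma has_bochner_integral_inner_two_gaussians:
  "has_bochner_integral lborel (\<lambda>y. (y \<bullet> b) * exp (- l * (norm y)\<^sup>2 - m * (norm (x - y))\<^sup>2))
     (m / (l + m) * (x \<bullet> b) * (exp (- (l * m / (l + m)) * (norm x)\<^sup>2) * sqrt (pi / (l + m)) ^ DIM('a)))"
proof -
  let ?c = "(m / (l + m)) *\<^sub>R x"
  let ?g = "\<lambda>y. exp (- (l + m) * (norm y)\<^sup>2)"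
  have "has_bochner_integral lborel (\<lambda>y. ((y - ?c) \<bullet> b) * ?g (y - ?c)) 0"
    by (rule has_bochner_integral_lborel_shift[of "\<lambda>y. (y \<bullet> b) * ?g y"]) (rule has_bochner_integral_inner_gaussian[OF lm])
  moreover have "has_bochner_integral lborel (\<lambda>y. (?c \<bullet> b) * ?g (y - ?c)) ((?c \<bullet> b) * sqrt (pi / (l + m)) ^ DIM('a))"
    using has_bochner_integral_lborel_shift[OF has_bochner_integral_gaussian[OF lm], of ?c]
    by (rule has_bochner_integral_mult_right)
  ultimately have "has_bochner_integral lborel (\<lambda>y. ((y - ?c) \<bullet> b) * ?g (y - ?c) + (?c \<bullet> b) * ?g (y - ?c))
      (0 + (?c \<bullet> b) * sqrt (pi / (l + m)) ^ DIM('a))"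
    by (rule has_bochner_integral_add)
  then have "has_bochner_integral lborel (\<lambda>y. exp (- (l * m / (l + m)) * (norm x)\<^sup>2) * (((y - ?c) \<bullet> b) * ?g (y - ?c) + (?c \<bullet> b) * ?g (y - ?c)))
      (exp (- (l * m / (l + m)) * (norm x)\<^sup>2) * (0 + (?c \<bullet> b) * sqrt (pi / (l + m)) ^ DIM('a)))"
    by (rule has_bochner_integral_mult_right)
  moreover have "E * (((y - ?c) \<bullet> b) * G + (?c \<bullet> b) * G) = (y \<bullet> b) * (E * G)" for y and E G :: real
    by (simp add: inner_diff_left algebra_simps)
  moreover have "E * (0 + (?c \<bullet> b) * G) = m / (l + m) * (x \<bullet> b) * (E * G)" for E G :: real
    by simp
  ultimately show ?thesis unfolding exp_complete_square by (simp only:)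
qed

end

text \<open>Euler's integral after rescaling by \<open>d\<close>. It presents a negative power of
  \<open>d\<close> as a mixture of the exponentials exp(-m d), to be used with d = |x -
  y|^2.\<close>

lemma has_bochner_integral_gamma_scaled:
  assumes z: "z > (0::real)" and d: "d > 0"
  shows "has_bochner_integral lborel (\<lambda>m. indicator {0<..} m * m powr (z - 1) * exp (- (m * d))) (Gamma z * d powr (- z))"
proof -
  have "has_bochner_integral lborel (\<lambda>t. indicator {0..} t * t powr (z - 1) / exp t) (Gamma z)"
    by (rule has_bochner_integral_nn_integral)
      (use z Gamma_conv_nn_integral_real[OF z] Gamma_real_pos[OF z] in \<open>auto intro!: mult_nonneg_nonneg\<close>)
  then have "has_bochner_integral lborel (\<lambda>m. indicator {0..} (0 + d * m) * (0 + d * m) powr (z - 1) / exp (0 + d * m)) (Gamma z /\<^sub>R \<bar>d\<bar>)"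
    using d by (subst (asm) lborel_has_bochner_integral_real_affine_iff[where c=d and t=0]) auto
  \<comment> \<open>The prefactor strips \<open>d\<close> from \<open>(d * m) powr (z - 1)\<close>;
    together with the Jacobian 1/d it leaves \<open>d powr (- z)\<close>.\<close>
  then have "has_bochner_integral lborel (\<lambda>m. d powr (1 - z) * (indicator {0..} (0 + d * m) * (0 + d * m) powr (z - 1) / exp (0 + d * m)))
      (d powr (1 - z) * (Gamma z /\<^sub>R \<bar>d\<bar>))"
    by (rule has_bochner_integral_mult_right)
  moreover have "d powr (1 - z) * (indicator {0..} (0 + d * m) * (0 + d * m) powr (z - 1) / exp (0 + d * m)) =
      indicator {0<..} m * m powr (z - 1) * exp (- (m * d))" for m
  proof (cases "m > 0")
    case True
    have "d powr (1 - z) * d powr (z - 1) = 1" using d by (simp add: powr_add[symmetric])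
    then have "d powr (1 - z) * (d * m) powr (z - 1) = m powr (z - 1)"
      using True d by (simp add: powr_mult mult.assoc[symmetric])
    then show ?thesis using True d by (simp add: exp_minus field_simps)
  next
    case False
    then have "m = 0 \<or> d * m < 0" using d by (auto simp: mult_less_0_iff)
    then show ?thesis using False by auto
  qed
  moreover have "d powr (1 - z) * (Gamma z /\<^sub>R \<bar>d\<bar>) = Gamma z * d powr (- z)"
    using d by (simp add: powr_diff powr_minus field_simps)
  ultimately show ?thesis by (simp only:)
qed

text \<open>The substitution is t^2 = m / (l + m). With u = 1 - t^2 one has m = t^2 l/u, l + m = l/u
  and dm = (2 l t / u^2) dt. The two powers of l/u multiply to (u/l)^2, which cancels the u^2 of the
  Jacobian and leaves t^(p-4) * t * 2/l. The exponent p/2 - 2 comes from the Gamma mixture, the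
  exponent -p/2 from the mass of the completed Gaussian.\<close>

lemma has_bochner_integral_mobius_substitution:
  fixes H :: "real \<Rightarrow> real" and p :: nat
  assumes l: "l > 0" and p: "p \<ge> 3" and H: "continuous_on UNIV H" and H0: "\<And>u. H u \<ge> 0"
  shows "has_bochner_integral lborel
    (\<lambda>m. indicator {0<..} m * (m powr (p / 2 - 2) * (l + m) powr (- (p / 2)) * H (m / (l + m))))
    (2 / l * (LINT t:{0..1}|lborel. t ^ (p - 3) * H (t\<^sup>2)))"
proof -
  define f where "f m = m powr (p / 2 - 2) * (l + m) powr (- (p / 2)) * H (m / (l + m))" for m
  define g where "g t = l * t\<^sup>2 / (1 - t\<^sup>2)" for t
  define g' where "g' t = 2 * l * t / (1 - t\<^sup>2)\<^sup>2" for t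
  have sq: "0 < t\<^sup>2" "t\<^sup>2 < 1" if "0 < t" "t < 1" for t :: real
    using that by (auto simp: power_less_one_iff)
  have g_pos: "g t > 0" if "0 < t" "t < 1" for t
    using sq[OF that] l by (simp add: g_def)
  have g_shift: "l + g t = l / (1 - t\<^sup>2)" if "0 < t" "t < 1" for t
    using sq[OF that] by (simp add: g_def field_simps)
  have g_ratio: "g t / (l + g t) = t\<^sup>2" if "0 < t" "t < 1" for t
    unfolding g_shift[OF that] using sq[OF that] l by (simp add: g_def)
  have fg: "f (g t) * g' t = 2 / l * (t ^ (p - 3) * H (t\<^sup>2))" if t: "0 < t" "t < 1" for t
  proof -
    define u where "u = 1 - t\<^sup>2"
    have u: "u > 0" using sq[OF t] by (simp add: u_def)
    have "g t powr (p / 2 - 2) = t powr (real p - 4) * (l / u) powr (p / 2 - 2)"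
    proof -
      have "g t = t\<^sup>2 * (l / u)" by (simp add: g_def u_def)
      moreover have "(t\<^sup>2) powr (p / 2 - 2) = t powr (real p - 4)"
      proof -
        have "(t\<^sup>2) powr (p / 2 - 2) = (t powr 2) powr (p / 2 - 2)" using t by simp
        also have "\<dots> = t powr (2 * (p / 2 - 2))" by (rule powr_powr)
        finally show ?thesis by simp
      qed
      ultimately show ?thesis using t u l by (simp only: powr_mult)
    qed
    then have "f (g t) * g' t = t powr (real p - 4) * (l / u) powr (p / 2 - 2) * (l / u) powr (- (p / 2)) * H (t\<^sup>2) * (2 * l * t / u\<^sup>2)"
      unfolding f_def
      unfolding g_ratio[OF t]
      unfolding g_shift[OF t] g'_def u_def[symmetric] by (simp only:)
    also have "\<dots> = (t powr (real p - 4) * t) * H (t\<^sup>2) * ((l / u) powr (p / 2 - 2) * (l / u) powr (- (p / 2)) * (2 * l / u\<^sup>2))"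
      by (simp only: times_divide_eq_right times_divide_eq_left mult_ac)
    also have "(l / u) powr (p / 2 - 2) * (l / u) powr (- (p / 2)) = (u / l)\<^sup>2"
    proof -
      have "(l / u) powr (p / 2 - 2) * (l / u) powr (- (p / 2)) = (l / u) powr (- 2)"
        by (simp add: powr_add[symmetric])
      also have "\<dots> = inverse ((l / u)\<^sup>2)" using l u by (simp add: powr_minus)
      also have "\<dots> = (u / l)\<^sup>2" using l u by (simp add: field_simps)
      finally show ?thesis .
    qed
    also have "t powr (real p - 4) * t = t ^ (p - 3)"
    proof -
      have "t powr (real p - 4) * t = t powr (real p - 4) * t powr 1" using t by simp
      also have "\<dots> = t powr (real (p - 3))"
        unfolding powr_add[symmetric] using p by (simp add: of_nat_diff)
      finally show ?thesis using t by (simp add: powr_realpow)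
    qed
    also have "(u / l)\<^sup>2 * (2 * l / u\<^sup>2) = 2 / l" using l u by (simp add: power2_eq_square field_simps)
    finally show ?thesis by simp
  qed
  have ein: "einterval (ereal 0) (ereal 1) = {0<..<1}" "einterval (ereal 0) \<infinity> = {0<..}"
    by (auto simp: einterval_def)
  have intR: "set_integrable lborel {0..1} (\<lambda>t. 2 / l * (t ^ (p - 3) * H (t\<^sup>2)))"
    using l by (intro borel_integrable_atLeastAtMost' continuous_intros continuous_on_compose2[OF H]) auto
  have intL: "set_integrable lborel (einterval (ereal 0) (ereal 1)) (\<lambda>t. f (g t) * g' t)"
  proof -
    have "set_integrable lborel {0<..<1} (\<lambda>t. 2 / l * (t ^ (p - 3) * H (t\<^sup>2)))"
      by (rule set_integrable_subset[OF intR]) auto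
    then show ?thesis unfolding ein
      by (rule set_integrable_cong[THEN iffD1, rotated -1]) (auto simp: fg)
  qed
  have tend0: "((ereal \<circ> g \<circ> real_of_ereal) \<longlongrightarrow> ereal 0) (at_right (ereal 0))"
  proof -
    have "(g \<longlongrightarrow> g 0) (at_right 0)"
      unfolding g_def by (intro tendsto_intros) auto
    then show ?thesis by (simp add: ereal_tendsto_simps g_def)
  qed
  have tend1: "((ereal \<circ> g \<circ> real_of_ereal) \<longlongrightarrow> \<infinity>) (at_left (ereal 1))"
  proof -
    have "((\<lambda>t. l * t\<^sup>2) \<longlongrightarrow> l * 1\<^sup>2) (at_left 1)" by (intro tendsto_intros)
    moreover have "filterlim (\<lambda>t::real. inverse (1 - t\<^sup>2)) at_top (at_left 1)"
    proof (rule filterlim_inverse_at_top)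
      have "((\<lambda>t::real. 1 - t\<^sup>2) \<longlongrightarrow> 1 - 1\<^sup>2) (at_left 1)" by (intro tendsto_intros)
      then show "((\<lambda>t::real. 1 - t\<^sup>2) \<longlongrightarrow> 0) (at_left 1)" by simp
      show "\<forall>\<^sub>F t::real in at_left 1. 0 < 1 - t\<^sup>2"
        using eventually_at_left_real[of 0 1] by (rule eventually_mono) (auto simp: power_less_one_iff)
    qed
    ultimately have "filterlim (\<lambda>t. l * t\<^sup>2 * inverse (1 - t\<^sup>2)) at_top (at_left 1)"
      using l by (intro filterlim_tendsto_pos_mult_at_top) auto
    then have "filterlim g at_top (at_left 1)" by (simp add: g_def[abs_def] divide_inverse)
    then have "((ereal \<circ> g) \<longlongrightarrow> \<infinity>) (at_left 1)"
      by (simp add: tendsto_PInfty_eq_at_top comp_def)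
    then show ?thesis by (simp only: ereal_tendsto_simps1)
  qed
  have der: "DERIV g t :> g' t" if "0 < t" "t < 1" for t
  proof -
    have "((\<lambda>t. l * t\<^sup>2 / (1 - t\<^sup>2)) has_real_derivative
        (l * (2 * t) * (1 - t\<^sup>2) - l * t\<^sup>2 * (0 - 2 * t)) / ((1 - t\<^sup>2) * (1 - t\<^sup>2))) (at t)"
      using sq[OF that]
      by (intro DERIV_divide DERIV_cmult DERIV_diff DERIV_const) (auto intro!: derivative_eq_intros)
    also have "l * (2 * t) * (1 - t\<^sup>2) - l * t\<^sup>2 * (0 - 2 * t) = 2 * l * t"
      by (simp add: algebra_simps)
    finally show ?thesis unfolding g_def g'_def power2_eq_square[of "1 - t\<^sup>2"] .
  qed
  have cg': "isCont g' t" if "0 < t" "t < 1" for t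
    unfolding g'_def using sq[OF that] by (intro continuous_intros) auto
  have cf: "isCont f (g t)" if "0 < t" "t < 1" for t
  proof -
    have "isCont (\<lambda>m. m / (l + m)) (g t)"
      using g_pos[OF that] l by (intro continuous_divide continuous_add continuous_const continuous_ident) simp
    moreover have "isCont H u" for u
      using H by (simp add: continuous_on_eq_continuous_at)
    ultimately have "isCont (\<lambda>m. H (m / (l + m))) (g t)"
      by (rule isCont_o2)
    moreover have "isCont (\<lambda>m. m powr (p / 2 - 2)) (g t)" "isCont (\<lambda>m. (l + m) powr (- (p / 2))) (g t)"
      using g_pos[OF that] l by (intro continuous_at_within_powr continuous_add continuous_const continuous_ident; simp)+
    ultimately show ?thesis unfolding f_def by (intro continuous_mult)
  qed
  \<comment> \<open>For nonnegative integrands this rule delivers integrability over the unbounded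
    interval along with the value; \<open>H0\<close> enters here.\<close>
  note subst = interval_integral_substitution_nonneg[of "ereal 0" "ereal 1" g g' f "ereal 0" \<infinity>,
      OF _ _ _ _ _ _ tend0 tend1 intL]
  have 1: "set_integrable lborel (einterval (ereal 0) \<infinity>) f"
    by (rule subst(1)) (use der cf cg' l H0 in \<open>auto simp: f_def g'_def\<close>)
  have 2: "(LBINT x=ereal 0..\<infinity>. f x) = (LBINT x=ereal 0..ereal 1. f (g x) * g' x)"
    by (rule subst(2)) (use der cf cg' l H0 in \<open>auto simp: f_def g'_def\<close>)
  also have "\<dots> = (LINT t:{0<..<1}|lborel. 2 / l * (t ^ (p - 3) * H (t\<^sup>2)))"
  proof -
    have "(LINT t:{0<..<1}|lborel. f (g t) * g' t) = (LINT t:{0<..<1}|lborel. 2 / l * (t ^ (p - 3) * H (t\<^sup>2)))"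
      by (rule set_lebesgue_integral_cong) (simp_all add: fg)
    then show ?thesis by (simp add: interval_lebesgue_integral_def ein)
  qed
  also have "\<dots> = 2 / l * (LINT t:{0..1}|lborel. t ^ (p - 3) * H (t\<^sup>2))"
  proof -
    have "(LINT t:{0<..<1}|lborel. t ^ (p - 3) * H (t\<^sup>2)) = (LINT t:{0..1}|lborel. t ^ (p - 3) * H (t\<^sup>2))"
      unfolding set_lebesgue_integral_def
    proof (rule integral_cong_AE)
      show "AE t in lborel. indicat_real {0<..<1} t *\<^sub>R (t ^ (p - 3) * H (t\<^sup>2)) = indicat_real {0..1} t *\<^sub>R (t ^ (p - 3) * H (t\<^sup>2))"
        using AE_lborel_singleton[of 0] AE_lborel_singleton[of 1]
        by eventually_elim (auto simp: indicator_def)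
    qed (use borel_measurable_continuous_onI[OF H] in measurable)
    then show ?thesis by simp
  qed
  finally show ?thesis
    using 1 unfolding ein interval_lebesgue_integral_def set_integrable_def set_lebesgue_integral_def
    by (simp add: has_bochner_integral_iff f_def ein)
qed

subsection \<open>The Newtonian kernel as a mixture of Gaussians\<close>

context
  fixes x :: "'a::euclidean_space" and V :: "real \<Rightarrow> real" and w :: "'a \<Rightarrow> real" and k l l' C :: real
  assumes dim: "DIM('a) \<ge> 3" and l: "l > 0" and l': "l' > 0"
    and V: "continuous_on UNIV V" and V0: "\<And>u. u \<ge> 0 \<Longrightarrow> V u \<ge> 0"
    and w [measurable]: "w \<in> borel_measurable borel"
    and w_bound: "\<And>y. \<bar>w y\<bar> * exp (- l * (norm y)\<^sup>2) \<le> C * exp (- l' * (norm y)\<^sup>2)"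
    and w_int: "\<And>m. m > 0 \<Longrightarrow> has_bochner_integral lborel
       (\<lambda>y. w y * exp (- l * (norm y)\<^sup>2 - m * (norm (x - y))\<^sup>2))
       (k * V (m / (l + m)) * (exp (- (l * m / (l + m)) * (norm x)\<^sup>2) * sqrt (pi / (l + m)) ^ DIM('a)))"
begin

lemma sqrt_pi_power: "m > 0 \<Longrightarrow> L > 0 \<Longrightarrow> sqrt (pi / (L + m)) ^ DIM('a) = pi powr (DIM('a) / 2) * (L + m) powr (- (DIM('a) / 2))"
  by (simp add: powr_half_sqrt[symmetric] powr_realpow[symmetric] powr_powr powr_divide powr_minus_divide)

text \<open>The dominating function for the Fubini argument that follows. It is nonnegative, so a
  finite iterated integral suffices: the \<open>y\<close>-integral is a completed square, and the
  \<open>m\<close>-integral that remains is the substitution lemma with an exponential for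
  \<open>H\<close>.\<close>

lemma integrable_two_gaussian_mixture:
  "integrable (lborel \<Otimes>\<^sub>M lborel) (\<lambda>(m, y). indicator {0<..} m * m powr (DIM('a) / 2 - 2) * exp (- l' * (norm y)\<^sup>2 - m * (norm (x - y))\<^sup>2))"
  (is "integrable _ (case_prod ?f)")
proof (rule lborel_pair.Fubini_integrable)
  let ?H = "\<lambda>u. exp (- (l' * u) * (norm x)\<^sup>2)"
  have int: "integrable lborel (?f m)" for m
    using has_bochner_integral_two_gaussians[of l' m x] l'
    by (cases "m > 0") (auto simp: has_bochner_integral_iff)
  then show "AE m in lborel. integrable lborel (\<lambda>y. case_prod ?f (m, y))" by simp
  have "integrable lborel (\<lambda>m. pi powr (DIM('a) / 2) * (indicator {0<..} m * (m powr (DIM('a) / 2 - 2) * (l' + m) powr (- (DIM('a) / 2)) * ?H (m / (l' + m)))))"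
    by (intro integrable_mult_right integrable.intros[OF has_bochner_integral_mobius_substitution[OF l' dim]] continuous_intros) auto
  also have "(\<lambda>m. pi powr (DIM('a) / 2) * (indicator {0<..} m * (m powr (DIM('a) / 2 - 2) * (l' + m) powr (- (DIM('a) / 2)) * ?H (m / (l' + m)))))
      = (\<lambda>m. LINT y|lborel. norm (case_prod ?f (m, y)))"
  proof
    fix m :: real
    show "pi powr (DIM('a) / 2) * (indicator {0<..} m * (m powr (DIM('a) / 2 - 2) * (l' + m) powr (- (DIM('a) / 2)) * ?H (m / (l' + m)))) =
        (LINT y|lborel. norm (case_prod ?f (m, y)))"
    proof (cases "m > 0")
      case True
      have "(LINT y|lborel. norm (case_prod ?f (m, y))) = (LINT y|lborel. m powr (DIM('a) / 2 - 2) * exp (- l' * (norm y)\<^sup>2 - m * (norm (x - y))\<^sup>2))"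
        using True by simp
      also have "\<dots> = m powr (DIM('a) / 2 - 2) * (exp (- (l' * m / (l' + m)) * (norm x)\<^sup>2) * sqrt (pi / (l' + m)) ^ DIM('a))"
        using has_bochner_integral_two_gaussians[of l' m x] l' True by (simp add: has_bochner_integral_iff)
      also have "\<dots> = pi powr (DIM('a) / 2) * (indicator {0<..} m * (m powr (DIM('a) / 2 - 2) * (l' + m) powr (- (DIM('a) / 2)) * ?H (m / (l' + m))))"
        unfolding sqrt_pi_power[OF True l'] using True by simp
      finally show ?thesis by (rule sym)
    qed simp
  qed
  finally show "integrable lborel (\<lambda>m. LINT y|lborel. norm (case_prod ?f (m, y)))" .
qed measurable

text \<open>Fubini for the mixture: integrating over \<open>m\<close> first produces Gamma(p/2 - 1)
  times the Newtonian kernel, integrating over \<open>y\<close> first produces \<open>w_int\<close>,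
  with p = DIM('a). The separate exponent \<open>l'\<close> in \<open>w_bound\<close> leaves room
  for a weight \<open>w\<close> that grows.\<close>

lemma has_bochner_integral_newtonian_gaussian:
  "has_bochner_integral lborel (\<lambda>y. norm (x - y) powr (2 - real DIM('a)) * w y * exp (- l * (norm y)\<^sup>2))
     (2 * pi powr (DIM('a) / 2) / (l * Gamma (DIM('a) / 2 - 1)) * k *
       (LINT t:{0..1}|lborel. t ^ (DIM('a) - 3) * (V (t\<^sup>2) * exp (- l * t\<^sup>2 * (norm x)\<^sup>2))))"
proof -
  let ?f = "\<lambda>m y. indicator {0<..} m * m powr (DIM('a) / 2 - 2) * (w y * exp (- l * (norm y)\<^sup>2 - m * (norm (x - y))\<^sup>2))"
  \<comment> \<open>\<open>V\<close> is known to be nonnegative only on u \<ge> 0, while the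
    substitution asks it of \<open>H\<close> everywhere; the absolute value changes nothing at the
    arguments m / (l + m) and t^2.\<close>
  define H where "H u = V \<bar>u\<bar> * exp (- (l * u) * (norm x)\<^sup>2)" for u
  have cH: "continuous_on UNIV H"
    unfolding H_def by (intro continuous_intros continuous_on_compose2[OF V]) auto
  have H0: "H u \<ge> 0" for u by (simp add: H_def V0)
  \<comment> \<open>Then z - 1 = p/2 - 2 is the exponent of the mixing weight and -2z = 2 - p that
    of the kernel; p \<ge> 3 makes \<open>z\<close> positive.\<close>
  define z where "z = DIM('a) / 2 - 1"
  have z: "z > 0" using dim by (simp add: z_def)
  have int: "integrable (lborel \<Otimes>\<^sub>M lborel) (case_prod ?f)"
  proof (rule Bochner_Integration.integrable_bound[OF integrable_mult_right[OF integrable_two_gaussian_mixture, of C]])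
    show "AE p in lborel \<Otimes>\<^sub>M lborel. norm (case_prod ?f p) \<le>
        norm (C * (case p of (m, y) \<Rightarrow> indicator {0<..} m * m powr (DIM('a) / 2 - 2) * exp (- l' * (norm y)\<^sup>2 - m * (norm (x - y))\<^sup>2)))"
    proof (rule AE_I2, clarify)
      fix m y
      have "\<bar>w y\<bar> * exp (- l * (norm y)\<^sup>2 - m * (norm (x - y))\<^sup>2) = (\<bar>w y\<bar> * exp (- l * (norm y)\<^sup>2)) * exp (- m * (norm (x - y))\<^sup>2)"
        by (simp add: exp_add[symmetric])
      also have "\<dots> \<le> (C * exp (- l' * (norm y)\<^sup>2)) * exp (- m * (norm (x - y))\<^sup>2)"
        by (intro mult_right_mono w_bound) simp
      also have "\<dots> = C * exp (- l' * (norm y)\<^sup>2 - m * (norm (x - y))\<^sup>2)"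
        by (simp add: exp_add[symmetric])
      finally have "indicator {0<..} m * m powr (DIM('a) / 2 - 2) * (\<bar>w y\<bar> * exp (- l * (norm y)\<^sup>2 - m * (norm (x - y))\<^sup>2))
         \<le> indicator {0<..} m * m powr (DIM('a) / 2 - 2) * (C * exp (- l' * (norm y)\<^sup>2 - m * (norm (x - y))\<^sup>2))"
        by (intro mult_left_mono) auto
      also have "\<dots> \<le> \<bar>C * (indicator {0<..} m * m powr (DIM('a) / 2 - 2) * exp (- l' * (norm y)\<^sup>2 - m * (norm (x - y))\<^sup>2))\<bar>"
        by (simp add: mult_ac)
      finally show "norm (?f m y) \<le> norm (C * (indicator {0<..} m * m powr (DIM('a) / 2 - 2) * exp (- l' * (norm y)\<^sup>2 - m * (norm (x - y))\<^sup>2)))"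
        by (simp add: abs_mult)
    qed
  qed measurable
  \<comment> \<open>At \<open>y = x\<close> the Gamma integral diverges; this single point is
    discarded as a null set.\<close>
  have inner_m: "(LINT m|lborel. ?f m y) = Gamma z * (norm (x - y) powr (2 - real DIM('a)) * w y * exp (- l * (norm y)\<^sup>2))" if "y \<noteq> x" for y
  proof -
    have d: "(norm (x - y))\<^sup>2 > 0" using that by simp
    have "(LINT m|lborel. ?f m y) = (LINT m|lborel. w y * exp (- l * (norm y)\<^sup>2) * (indicator {0<..} m * m powr (z - 1) * exp (- (m * (norm (x - y))\<^sup>2))))"
      by (intro Bochner_Integration.integral_cong refl) (simp add: z_def exp_diff exp_minus field_simps)
    also have "\<dots> = w y * exp (- l * (norm y)\<^sup>2) * (Gamma z * ((norm (x - y))\<^sup>2) powr (- z))"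
      using has_bochner_integral_gamma_scaled[OF z d] by (simp add: has_bochner_integral_iff)
    also have "((norm (x - y))\<^sup>2) powr (- z) = norm (x - y) powr (2 - real DIM('a))"
    proof -
      have "((norm (x - y))\<^sup>2) powr (- z) = (norm (x - y) powr 2) powr (- z)" using d by simp
      also have "\<dots> = norm (x - y) powr (2 * (- z))" by (rule powr_powr)
      finally show ?thesis by (simp add: z_def)
    qed
    finally show ?thesis by (simp add: mult_ac)
  qed
  have ae: "AE y in lborel. (LINT m|lborel. ?f m y) = Gamma z * (norm (x - y) powr (2 - real DIM('a)) * w y * exp (- l * (norm y)\<^sup>2))"
    using AE_lborel_singleton[of x] by eventually_elim (rule inner_m)
  have meas: "(\<lambda>y. LINT m|lborel. ?f m y) \<in> borel_measurable lborel"
    using lborel_pair.integrable_snd[OF int] by (rule borel_measurable_integrable)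
  have "integrable lborel (\<lambda>y. Gamma z * (norm (x - y) powr (2 - real DIM('a)) * w y * exp (- l * (norm y)\<^sup>2)))"
    using lborel_pair.integrable_snd[OF int] by (rule integrable_cong_AE_imp) (use ae in \<open>auto\<close>)
  then have i: "integrable lborel (\<lambda>y. norm (x - y) powr (2 - real DIM('a)) * w y * exp (- l * (norm y)\<^sup>2))"
    using Gamma_real_pos[OF z] by simp
  have "Gamma z * (LINT y|lborel. norm (x - y) powr (2 - real DIM('a)) * w y * exp (- l * (norm y)\<^sup>2)) = (LINT y|lborel. LINT m|lborel. ?f m y)"
    unfolding integral_mult_right_zero[symmetric]
    by (rule integral_cong_AE) (use meas ae in \<open>auto\<close>)
  also have "\<dots> = (LINT m|lborel. LINT y|lborel. ?f m y)"
    using lborel_pair.integral_fst[OF int] lborel_pair.integral_snd[OF int] by simp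
  also have "\<dots> = (LINT m|lborel. pi powr (DIM('a) / 2) * k * (indicator {0<..} m * (m powr (DIM('a) / 2 - 2) * (l + m) powr (- (DIM('a) / 2)) * H (m / (l + m)))))"
  proof (intro Bochner_Integration.integral_cong refl)
    fix m :: real
    show "(LINT y|lborel. ?f m y) = pi powr (DIM('a) / 2) * k * (indicator {0<..} m * (m powr (DIM('a) / 2 - 2) * (l + m) powr (- (DIM('a) / 2)) * H (m / (l + m))))"
    proof (cases "m > 0")
      case True
      have "(LINT y|lborel. ?f m y) = m powr (DIM('a) / 2 - 2) * (LINT y|lborel. w y * exp (- l * (norm y)\<^sup>2 - m * (norm (x - y))\<^sup>2))"
        using True by simp
      also have "\<dots> = m powr (DIM('a) / 2 - 2) * (k * V (m / (l + m)) * (exp (- (l * m / (l + m)) * (norm x)\<^sup>2) * sqrt (pi / (l + m)) ^ DIM('a)))"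
        using w_int[OF True] by (simp add: has_bochner_integral_iff)
      finally show ?thesis
        unfolding sqrt_pi_power[OF True l] using True l by (simp add: H_def)
    qed simp
  qed
  also have "\<dots> = pi powr (DIM('a) / 2) * k * (2 / l * (LINT t:{0..1}|lborel. t ^ (DIM('a) - 3) * H (t\<^sup>2)))"
    using has_bochner_integral_mobius_substitution[OF l dim cH H0] by (simp add: has_bochner_integral_iff)
  finally have "(LINT y|lborel. norm (x - y) powr (2 - real DIM('a)) * w y * exp (- l * (norm y)\<^sup>2)) =
      2 * pi powr (DIM('a) / 2) / (l * Gamma z) * k * (LINT t:{0..1}|lborel. t ^ (DIM('a) - 3) * H (t\<^sup>2))"
    using Gamma_real_pos[OF z] l by (simp add: field_simps)
  then show ?thesis using i by (simp add: has_bochner_integral_iff H_def z_def mult.assoc)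
qed

end

subsection \<open>Tail integrals\<close>

text \<open>The factor \<open>s\<close> makes the integrand an exact derivative, so the tail
  integral reproduces the Gaussian up to 1 / (2 l). This has the same dependence on \<open>l\<close>
  as the factor 2 / l of the substitution, which is why one constant serves all Gaussians.\<close>

lemma has_bochner_integral_gaussian_tail:
  assumes l: "l > (0::real)" and u: "u \<ge> 0"
  shows "has_bochner_integral lborel (\<lambda>s. s * indicator {u..} s * exp (- l * s\<^sup>2)) (exp (- l * u\<^sup>2) / (2 * l))"
proof (rule has_bochner_integral_nn_integral)
  have "((\<lambda>s. - exp (- l * s\<^sup>2) / (2 * l)) \<longlongrightarrow> - 0 / (2 * l)) at_top"
  proof (intro tendsto_intros filterlim_compose[OF exp_at_bot])
    have "filterlim (\<lambda>s::real. l * s\<^sup>2) at_top at_top"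
      using l by (intro filterlim_tendsto_pos_mult_at_top[OF tendsto_const] filterlim_pow_at_top filterlim_ident) auto
    then show "filterlim (\<lambda>s. - l * s\<^sup>2) at_bot at_top"
      by (simp add: filterlim_uminus_at_top)
  qed (use l in auto)
  then have "(\<integral>\<^sup>+s. ennreal (s * exp (- l * s\<^sup>2)) * indicator {u..} s \<partial>lborel) = ennreal (- 0 / (2 * l) - (- exp (- l * u\<^sup>2) / (2 * l)))"
    using l u by (intro nn_integral_FTC_atLeast) (auto intro!: derivative_eq_intros simp: field_simps)
  moreover have "ennreal (s * indicator {u..} s * exp (- l * s\<^sup>2)) = ennreal (s * exp (- l * s\<^sup>2)) * indicator {u..} s" for s
    by (simp add: indicator_def)
  ultimately show "(\<integral>\<^sup>+s. ennreal (s * indicator {u..} s * exp (- l * s\<^sup>2)) \<partial>lborel) = ennreal (exp (- l * u\<^sup>2) / (2 * l))"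
    by simp
qed (use l u in \<open>auto simp: indicator_def\<close>)

text \<open>The double integral of \<open>tail_weight W r (t, s) * g s\<close> is the integral of
  \<open>W t * tail_F g (t * r)\<close> over \<open>{0..1}\<close>; unlike the latter it is visibly an integral of \<open>g\<close>
  against a fixed measure.\<close>

definition tail_weight :: "(real \<Rightarrow> real) \<Rightarrow> real \<Rightarrow> real \<times> real \<Rightarrow> real" where
  "tail_weight W r = (\<lambda>(t, s). indicator {0..1} t * W t * (s * indicator {t * r..} s))"

lemma tail_weight_measurable [measurable]:
  assumes [measurable]: "W \<in> borel_measurable borel"
  shows "tail_weight W r \<in> borel_measurable (lborel \<Otimes>\<^sub>M lborel)"
proof -
  have "tail_weight W r = (\<lambda>p. indicator {0..1} (fst p) * W (fst p) * (snd p * (if fst p * r \<le> snd p then 1 else 0)))"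
    by (auto simp: tail_weight_def fun_eq_iff indicator_def)
  also have "\<dots> \<in> borel_measurable (lborel \<Otimes>\<^sub>M lborel)" by measurable
  finally show ?thesis .
qed

text \<open>The weight lives on s \<ge> t r \<ge> 0. This permits |s| as the statistic on the plane,
  since the uniqueness result asks for one that is nonnegative everywhere.\<close>

lemma tail_weight_abs:
  assumes "r \<ge> 0"
  shows "tail_weight W r p * g \<bar>snd p\<bar> = tail_weight W r p * g (snd p)"
proof (cases p)
  case (Pair t s)
  have "s \<ge> 0" if "0 \<le> t" "t * r \<le> s" using that assms by (meson mult_nonneg_nonneg order_trans)
  then show ?thesis by (auto simp: Pair tail_weight_def indicator_def)
qed

lemma has_bochner_integral_tail_weight_gaussian:
  assumes l: "l > 0" and r: "r \<ge> 0" and W: "continuous_on UNIV W"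
  shows "has_bochner_integral (lborel \<Otimes>\<^sub>M lborel) (\<lambda>p. tail_weight W r p * exp (- l * (snd p)\<^sup>2))
     (1 / (2 * l) * (LINT t:{0..1}|lborel. W t * exp (- l * t\<^sup>2 * r\<^sup>2)))"
proof -
  have [measurable]: "W \<in> borel_measurable borel" using W by (rule borel_measurable_continuous_onI)
  let ?f = "\<lambda>t s. tail_weight W r (t, s) * exp (- l * s\<^sup>2)"
  let ?h = "\<lambda>t. indicator {0..1} t * W t * (exp (- l * (t * r)\<^sup>2) / (2 * l))"
  have inner: "has_bochner_integral lborel (?f t) (?h t)" for t
  proof (cases "t \<in> {0..1}")
    case True
    then have "t * r \<ge> 0" using r by simp
    from has_bochner_integral_mult_right[OF has_bochner_integral_gaussian_tail[OF l this], of "W t"]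
    show ?thesis using True by (simp add: tail_weight_def mult.assoc)
  next
    case False
    then show ?thesis by (simp add: tail_weight_def has_bochner_integral_zero)
  qed
  \<comment> \<open>On the support of the weight \<open>s\<close> is nonnegative, so the absolute
    value falls on \<open>W\<close> alone and the same tail formula applies.\<close>
  have nn: "norm (?f t s) = tail_weight (\<lambda>t. \<bar>W t\<bar>) r (t, s) * exp (- l * s\<^sup>2)" for t s
  proof -
    have "s \<ge> 0" if "0 \<le> t" "t * r \<le> s" using that r by (meson mult_nonneg_nonneg order_trans)
    then show ?thesis by (auto simp: tail_weight_def indicator_def abs_mult)
  qed
  have inner_abs: "(LINT s|lborel. norm (?f t s)) = \<bar>?h t\<bar>" for t
  proof (cases "t \<in> {0..1}")
    case True
    then have "t * r \<ge> 0" using r by simp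
    from has_bochner_integral_mult_right[OF has_bochner_integral_gaussian_tail[OF l this], of "\<bar>W t\<bar>"]
    show ?thesis using True l unfolding nn by (simp add: tail_weight_def mult.assoc has_bochner_integral_iff abs_mult)
  next
    case False
    then show ?thesis by (simp add: tail_weight_def)
  qed
  have hi: "integrable lborel ?h"
  proof -
    have "set_integrable lborel {0..1} (\<lambda>t. W t * (exp (- l * (t * r)\<^sup>2) / (2 * l)))"
      using l by (intro borel_integrable_atLeastAtMost' continuous_intros continuous_on_subset[OF W]) auto
    then show ?thesis by (simp add: set_integrable_def mult.assoc)
  qed
  have int: "integrable (lborel \<Otimes>\<^sub>M lborel) (\<lambda>p. tail_weight W r p * exp (- l * (snd p)\<^sup>2))"
  proof (rule lborel_pair.Fubini_integrable)
    show "AE t in lborel. integrable lborel (\<lambda>s. tail_weight W r (t, s) * exp (- l * (snd (t, s))\<^sup>2))"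
      using inner by (auto simp: has_bochner_integral_iff)
    show "integrable lborel (\<lambda>t. LINT s|lborel. norm (tail_weight W r (t, s) * exp (- l * (snd (t, s))\<^sup>2)))"
      using integrable_abs[OF hi] unfolding inner_abs[symmetric] by simp
  qed measurable
  have "(\<integral>p. tail_weight W r p * exp (- l * (snd p)\<^sup>2) \<partial>(lborel \<Otimes>\<^sub>M lborel)) = (LINT t|lborel. LINT s|lborel. ?f t s)"
    using lborel_pair.integral_fst'[OF int] by simp
  also have "\<dots> = (LINT t|lborel. ?h t)"
    using inner by (simp add: has_bochner_integral_iff)
  also have "\<dots> = (LINT t|lborel. 1 / (2 * l) * (indicator {0..1} t * (W t * exp (- l * t\<^sup>2 * r\<^sup>2))))"
    by (intro Bochner_Integration.integral_cong refl) (simp add: power_mult_distrib)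
  also have "\<dots> = 1 / (2 * l) * (LINT t:{0..1}|lborel. W t * exp (- l * t\<^sup>2 * r\<^sup>2))"
    unfolding set_lebesgue_integral_def by simp
  finally show ?thesis using int by (simp only: has_bochner_integral_iff simp_thms)
qed

lemma integral_tail_weight:
  assumes "integrable (lborel \<Otimes>\<^sub>M lborel) (\<lambda>p. tail_weight W r p * g (snd p))"
  shows "(\<integral>p. tail_weight W r p * g (snd p) \<partial>(lborel \<Otimes>\<^sub>M lborel)) = (LINT t:{0..1}|lborel. W t * tail_F g (t * r))"
proof -
  have "(\<integral>p. tail_weight W r p * g (snd p) \<partial>(lborel \<Otimes>\<^sub>M lborel)) = (LINT t|lborel. LINT s|lborel. tail_weight W r (t, s) * g s)"
    using lborel_pair.integral_fst'[OF assms] by simp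
  also have "\<dots> = (LINT t|lborel. indicator {0..1} t * (W t * tail_F g (t * r)))"
  proof (intro Bochner_Integration.integral_cong refl)
    fix t :: real
    have "(LINT s|lborel. tail_weight W r (t, s) * g s) = (LINT s|lborel. (indicator {0..1} t * W t) * (indicator {t * r..} s * (s * g s)))"
      by (intro Bochner_Integration.integral_cong refl) (simp add: tail_weight_def mult_ac)
    then show "(LINT s|lborel. tail_weight W r (t, s) * g s) = indicator {0..1} t * (W t * tail_F g (t * r))"
      by (simp add: tail_F_def set_lebesgue_integral_def mult.assoc)
  qed
  finally show ?thesis by (simp add: set_lebesgue_integral_def)
qed

subsection \<open>Radial integrals against the Newtonian kernel\<close>

context
  fixes x :: "'a::euclidean_space" and V :: "real \<Rightarrow> real" and w :: "'a \<Rightarrow> real" and k :: real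
  assumes dim: "DIM('a) \<ge> 3" and V: "continuous_on UNIV V"
    and gauss: "\<And>l. l > 0 \<Longrightarrow>
      has_bochner_integral lborel (\<lambda>y. norm (x - y) powr (2 - real DIM('a)) * w y * exp (- l * (norm y)\<^sup>2))
       (2 * pi powr (DIM('a) / 2) / (l * Gamma (DIM('a) / 2 - 1)) * k *
         (LINT t:{0..1}|lborel. t ^ (DIM('a) - 3) * (V (t\<^sup>2) * exp (- l * t\<^sup>2 * (norm x)\<^sup>2))))"
begin

text \<open>The quotient of the tail constant 1 / (2 l) by the kernel constant 2 pi^(p/2) / (l
  Gamma(p/2 - 1)); \<open>l\<close> cancels.\<close>

private definition "c = Gamma (DIM('a) / 2 - 1) / (4 * pi powr (DIM('a) / 2))"
private definition "W t = t ^ (DIM('a) - 3) * V (t\<^sup>2)" for t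
private definition "k1 y = c * (norm (x - y) powr (2 - real DIM('a)) * w y)" for y
text \<open>The factor \<open>k\<close> is kept on the tail side and never divided out, because for
  a coordinate it is \<open>x \<bullet> b\<close>, which may be 0.\<close>

private definition "k2 p = k * tail_weight W (norm x) p" for p

private lemma W_cont: "continuous_on UNIV W"
  unfolding W_def by (intro continuous_intros continuous_on_compose2[OF V]) auto

private lemma W_meas [measurable]: "W \<in> borel_measurable borel"
  using W_cont by (rule borel_measurable_continuous_onI)

private lemma k1_gauss: "l > 0 \<Longrightarrow> has_bochner_integral lborel (\<lambda>y. k1 y * exp (- l * (norm y)\<^sup>2))
    (k * (1 / (2 * l) * (LINT t:{0..1}|lborel. W t * exp (- l * t\<^sup>2 * (norm x)\<^sup>2))))"
proof -
  assume l: "l > 0"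
  have "Gamma (DIM('a) / 2 - 1) > 0" using dim by (intro Gamma_real_pos) simp
  then have "c * (2 * pi powr (DIM('a) / 2) / (l * Gamma (DIM('a) / 2 - 1)) * k * I) = k * (1 / (2 * l) * I)" for I
    using l by (simp add: c_def field_simps)
  with has_bochner_integral_mult_right[OF gauss[OF l], of c] show ?thesis
    by (simp only: k1_def W_def mult.assoc)
qed

private lemma k2_gauss: "l > 0 \<Longrightarrow> has_bochner_integral (lborel \<Otimes>\<^sub>M lborel) (\<lambda>p. k2 p * exp (- l * \<bar>snd p\<bar>\<^sup>2))
    (k * (1 / (2 * l) * (LINT t:{0..1}|lborel. W t * exp (- l * t\<^sup>2 * (norm x)\<^sup>2))))"
  using has_bochner_integral_mult_right[OF has_bochner_integral_tail_weight_gaussian[OF _ _ W_cont, of l "norm x"], of k]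
  by (simp add: k2_def mult.assoc)

private lemmas k12 =
  integrable.intros[OF k1_gauss[of 1]] integrable.intros[OF k2_gauss[of 1]]
  has_bochner_integral_integral_eq[OF k1_gauss] has_bochner_integral_integral_eq[OF k2_gauss]

text \<open>The densities \<open>k1\<close> with statistic \<open>norm\<close> and \<open>k2\<close>
  with statistic |s| have the same Gaussian integrals, so they integrate every Borel
  \<open>g\<close> alike once both integrals exist. Unfolding the plane integral by Fubini restores
  \<open>tail_F\<close>.\<close>

lemma newtonian_radial_integral:
  assumes g [measurable]: "g \<in> borel_measurable borel"
    and i1: "integrable lborel (\<lambda>y. norm (x - y) powr (2 - real DIM('a)) * w y * g (norm y))"
    and i2: "integrable (lborel \<Otimes>\<^sub>M lborel) (\<lambda>p. tail_weight (\<lambda>t. t ^ (DIM('a) - 3) * V (t\<^sup>2)) (norm x) p * g (snd p))"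
  shows "Gamma (DIM('a) / 2 - 1) / (4 * pi powr (DIM('a) / 2)) *
      (LINT y|lborel. norm (x - y) powr (2 - real DIM('a)) * w y * g (norm y)) =
     k * (LINT t:{0..1}|lborel. t ^ (DIM('a) - 3) * V (t\<^sup>2) * tail_F g (t * norm x))"
proof -
  have k2: "k2 p * g \<bar>snd p\<bar> = k * (tail_weight W (norm x) p * g (snd p))" for p
    using tail_weight_abs[of "norm x" W p g] by (simp add: k2_def mult.assoc)
  have i2': "integrable (lborel \<Otimes>\<^sub>M lborel) (\<lambda>p. tail_weight W (norm x) p * g (snd p))"
    using i2 unfolding W_def[abs_def] .
  have "(LINT y|lborel. k1 y * g (norm y)) = (\<integral>p. k2 p * g \<bar>snd p\<bar> \<partial>(lborel \<Otimes>\<^sub>M lborel))"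
  proof (rule equal_gaussian_integrals[where ?N1.0=lborel and ?k1.0=k1 and ?S1.0=norm
        and ?N2.0="lborel \<Otimes>\<^sub>M lborel" and ?k2.0=k2 and ?S2.0="\<lambda>p. \<bar>snd p\<bar>" and g=g])
    show "integrable lborel (\<lambda>y. k1 y * g (norm y))"
      using integrable_mult_right[OF i1, of c] by (simp only: k1_def mult.assoc)
    show "integrable (lborel \<Otimes>\<^sub>M lborel) (\<lambda>p. k2 p * g \<bar>snd p\<bar>)"
      unfolding k2 by (rule integrable_mult_right[OF i2'])
    show "integrable lborel (\<lambda>y. k1 y * exp (- (norm y)\<^sup>2))"
      using k12(1) by simp
    show "integrable (lborel \<Otimes>\<^sub>M lborel) (\<lambda>p. k2 p * exp (- \<bar>snd p\<bar>\<^sup>2))"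
      using k12(2) by simp
    show "(LINT y|lborel. k1 y * exp (- l * (norm y)\<^sup>2)) = (\<integral>p. k2 p * exp (- l * \<bar>snd p\<bar>\<^sup>2) \<partial>(lborel \<Otimes>\<^sub>M lborel))"
      if "l \<ge> 1" for l using that by (simp only: k12(3,4))
  qed auto
  also have "\<dots> = k * (LINT t:{0..1}|lborel. W t * tail_F g (t * norm x))"
    unfolding k2 integral_mult_right_zero integral_tail_weight[OF i2'] ..
  finally show ?thesis
    by (simp add: k1_def W_def c_def mult.assoc)
qed

text \<open>Supplies the premise \<open>i2\<close> of \<open>newtonian_radial_integral\<close> when
  all data are nonnegative, by truncation; k > 0 allows the factor to be removed again.\<close>

lemma newtonian_radial_integrable:
  assumes g [measurable]: "g \<in> borel_measurable borel"
    and g0: "\<And>s. g s \<ge> 0" and w0: "\<And>y. w y \<ge> 0" and V0: "\<And>u. V u \<ge> 0" and k: "k > 0"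
    and i1: "integrable lborel (\<lambda>y. norm (x - y) powr (2 - real DIM('a)) * w y * g (norm y))"
  shows "integrable (lborel \<Otimes>\<^sub>M lborel) (\<lambda>p. tail_weight (\<lambda>t. t ^ (DIM('a) - 3) * V (t\<^sup>2)) (norm x) p * g (snd p))"
proof -
  have k2: "k2 p * g \<bar>snd p\<bar> = k * (tail_weight W (norm x) p * g (snd p))" for p
    using tail_weight_abs[of "norm x" W p g] by (simp add: k2_def mult.assoc)
  have tw: "0 \<le> tail_weight W (norm x) (t, s)" for t s
  proof -
    have "s \<ge> 0" if "0 \<le> t" "t * norm x \<le> s" using that by (meson mult_nonneg_nonneg norm_ge_zero order_trans)
    then show ?thesis using V0 by (auto simp: tail_weight_def indicator_def W_def)
  qed
  have "Gamma (DIM('a) / 2 - 1) > 0" using dim by (intro Gamma_real_pos) simp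
  then have c: "c > 0" by (simp add: c_def)
  have "integrable (lborel \<Otimes>\<^sub>M lborel) (\<lambda>p. k2 p * g \<bar>snd p\<bar>)"
  proof (rule equal_gaussian_integrals_nonneg[where ?N1.0=lborel and ?k1.0=k1 and ?S1.0=norm
        and ?N2.0="lborel \<Otimes>\<^sub>M lborel" and ?k2.0=k2 and ?S2.0="\<lambda>p. \<bar>snd p\<bar>" and g=g])
    show "integrable lborel (\<lambda>y. k1 y * g (norm y))"
      using integrable_mult_right[OF i1, of c] by (simp only: k1_def mult.assoc)
    show "integrable lborel (\<lambda>y. k1 y * exp (- (norm y)\<^sup>2))"
      using k12(1) by simp
    show "integrable (lborel \<Otimes>\<^sub>M lborel) (\<lambda>p. k2 p * exp (- \<bar>snd p\<bar>\<^sup>2))"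
      using k12(2) by simp
    show "(LINT y|lborel. k1 y * exp (- l * (norm y)\<^sup>2)) = (\<integral>p. k2 p * exp (- l * \<bar>snd p\<bar>\<^sup>2) \<partial>(lborel \<Otimes>\<^sub>M lborel))"
      if "l \<ge> 1" for l using that by (simp only: k12(3,4))
    show "k1 y \<ge> 0" for y using c w0 by (simp add: k1_def)
    show "k2 p \<ge> 0" for p using k tw by (cases p) (simp add: k2_def)
    show "k2 \<in> borel_measurable (lborel \<Otimes>\<^sub>M lborel)" unfolding k2_def by measurable
  qed (use g0 in auto)
  then show ?thesis unfolding k2 W_def[abs_def] using k by simp
qed

end

section \<open>The scalar identity, the coordinate identities, and their transfer to general radial
  functions\<close>

lemma newtonian_gaussian_const:
  fixes x :: "'a::euclidean_space"
  assumes "DIM('a) \<ge> 3" "l > 0"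
  shows "has_bochner_integral lborel (\<lambda>y. norm (x - y) powr (2 - real DIM('a)) * 1 * exp (- l * (norm y)\<^sup>2))
       (2 * pi powr (DIM('a) / 2) / (l * Gamma (DIM('a) / 2 - 1)) * 1 *
         (LINT t:{0..1}|lborel. t ^ (DIM('a) - 3) * (1 * exp (- l * t\<^sup>2 * (norm x)\<^sup>2))))"
  by (rule has_bochner_integral_newtonian_gaussian[where w="\<lambda>_. 1" and V="\<lambda>_. 1" and C=1 and l'=l])
    (use assms has_bochner_integral_two_gaussians[of l _ x] in auto)

text \<open>\<open>V\<close> is the identity because the centre of the completed square carries the
  factor m / (l + m), which becomes t^2. The linear weight uses up half of the exponent, hence
  \<open>l / 2\<close>.\<close>

lemma newtonian_gaussian_inner:
  fixes x b :: "'a::euclidean_space"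
  assumes "DIM('a) \<ge> 3" and l: "l > 0"
  shows "has_bochner_integral lborel (\<lambda>y. norm (x - y) powr (2 - real DIM('a)) * (y \<bullet> b) * exp (- l * (norm y)\<^sup>2))
       (2 * pi powr (DIM('a) / 2) / (l * Gamma (DIM('a) / 2 - 1)) * (x \<bullet> b) *
         (LINT t:{0..1}|lborel. t ^ (DIM('a) - 3) * (t\<^sup>2 * exp (- l * t\<^sup>2 * (norm x)\<^sup>2))))"
proof (rule has_bochner_integral_newtonian_gaussian[where w="\<lambda>y. y \<bullet> b" and V="\<lambda>u. u" and C="norm b / sqrt l" and l'="l / 2"])
  show "has_bochner_integral lborel (\<lambda>y. (y \<bullet> b) * exp (- l * (norm y)\<^sup>2 - m * (norm (x - y))\<^sup>2))
       ((x \<bullet> b) * (m / (l + m)) * (exp (- (l * m / (l + m)) * (norm x)\<^sup>2) * sqrt (pi / (l + m)) ^ DIM('a)))"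
    if "m > 0" for m
    using has_bochner_integral_inner_two_gaussians[where l=l and m=m and x=x and b=b] that l
    unfolding mult.commute[of "x \<bullet> b"] by simp
  show "\<bar>y \<bullet> b\<bar> * exp (- l * (norm y)\<^sup>2) \<le> norm b / sqrt l * exp (- (l / 2) * (norm y)\<^sup>2)" for y
    using l by (rule inner_gaussian_bound)
qed (use assms in \<open>auto intro: continuous_on_id\<close>)

lemma newtonian_shrinkage:
  fixes x :: "'a::euclidean_space" and g :: "real \<Rightarrow> real"
  assumes dim: "DIM('a) \<ge> 3" and g [measurable]: "g \<in> borel_measurable borel" and g0: "\<And>s. g s \<ge> 0"
    and i: "integrable lborel (\<lambda>y. norm (x - y) powr (2 - real DIM('a)) * g (norm y))"
    and iy: "integrable lborel (\<lambda>y. (norm (x - y) powr (2 - real DIM('a)) * g (norm y)) *\<^sub>R y)"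
  defines "c \<equiv> Gamma (DIM('a) / 2 - 1) / (4 * pi powr (DIM('a) / 2))"
  shows "c * (LINT y|lborel. norm (x - y) powr (2 - real DIM('a)) * g (norm y)) =
      (LINT t:{0..1}|lborel. t ^ (DIM('a) - 3) * tail_F g (t * norm x))" (is ?scalar)
    and "c *\<^sub>R (LINT y|lborel. (norm (x - y) powr (2 - real DIM('a)) * g (norm y)) *\<^sub>R y) =
      (LINT t:{0..1}|lborel. t ^ (DIM('a) - 1) * tail_F g (t * norm x)) *\<^sub>R x" (is ?vector)
proof -
  have p: "t ^ (DIM('a) - 3) * t\<^sup>2 = t ^ (DIM('a) - 1)" for t :: real
  proof -
    have "DIM('a) - 1 = DIM('a) - 3 + 2" using dim by simp
    then show ?thesis by (simp only: power_add)
  qed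
  have int: "integrable (lborel \<Otimes>\<^sub>M lborel) (\<lambda>p. tail_weight (\<lambda>t. t ^ (DIM('a) - 3) * 1) (norm x) p * g (snd p))"
    by (rule newtonian_radial_integrable[where x=x and V="\<lambda>_. 1" and w="\<lambda>_. 1" and k=1, OF dim _ newtonian_gaussian_const[OF dim] g g0])
      (use i in auto)
  show ?scalar
    using newtonian_radial_integral[where x=x and V="\<lambda>_. 1" and w="\<lambda>_. 1" and k=1, OF dim _ newtonian_gaussian_const[OF dim] g _ int] i
    by (simp add: c_def)
  have int2: "integrable (lborel \<Otimes>\<^sub>M lborel) (\<lambda>p. tail_weight (\<lambda>t. t ^ (DIM('a) - 3) * t\<^sup>2) (norm x) p * g (snd p))"
  proof (rule Bochner_Integration.integrable_bound[OF int])
    show "AE p in lborel \<Otimes>\<^sub>M lborel. norm (tail_weight (\<lambda>t. t ^ (DIM('a) - 3) * t\<^sup>2) (norm x) p * g (snd p))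
        \<le> norm (tail_weight (\<lambda>t. t ^ (DIM('a) - 3) * 1) (norm x) p * g (snd p))"
    proof (rule AE_I2)
      fix p :: "real \<times> real"
      \<comment> \<open>The tail weight already contains this indicator; repeating it bounds the
        factor by 1 at every point of the plane.\<close>
      let ?e = "(fst p)\<^sup>2 * indicator {0..1} (fst p)" and ?A = "tail_weight (\<lambda>t. t ^ (DIM('a) - 3) * 1) (norm x) p * g (snd p)"
      have "tail_weight (\<lambda>t. t ^ (DIM('a) - 3) * t\<^sup>2) (norm x) p * g (snd p) = ?e * ?A"
        by (cases p) (simp add: tail_weight_def indicator_def)
      moreover have "\<bar>?e\<bar> \<le> 1"
        by (auto simp: indicator_def power_le_one)
      then have "\<bar>?e\<bar> * \<bar>?A\<bar> \<le> \<bar>?A\<bar>" by (intro mult_left_le_one_le) auto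
      ultimately show "norm (tail_weight (\<lambda>t. t ^ (DIM('a) - 3) * t\<^sup>2) (norm x) p * g (snd p)) \<le> norm ?A"
        unfolding real_norm_def by (simp only: abs_mult[of ?e])
    qed
  qed measurable
  show ?vector
  proof (rule euclidean_eqI)
    fix b :: 'a
    let ?I = "\<lambda>y. (norm (x - y) powr (2 - real DIM('a)) * g (norm y)) *\<^sub>R y"
    have I: "norm (x - y) powr (2 - real DIM('a)) * (y \<bullet> b) * g (norm y) = ?I y \<bullet> b" for y
      by (simp add: mult_ac)
    have "c * (LINT y|lborel. norm (x - y) powr (2 - real DIM('a)) * (y \<bullet> b) * g (norm y)) =
        (x \<bullet> b) * (LINT t:{0..1}|lborel. t ^ (DIM('a) - 3) * t\<^sup>2 * tail_F g (t * norm x))"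
      unfolding c_def
    proof (rule newtonian_radial_integral[where x=x and V="\<lambda>u. u" and w="\<lambda>y. y \<bullet> b", OF dim _ newtonian_gaussian_inner[OF dim] g _ int2])
      show "integrable lborel (\<lambda>y. norm (x - y) powr (2 - real DIM('a)) * (y \<bullet> b) * g (norm y))"
        unfolding I using iy by (rule integrable_inner_left)
    qed (auto intro: continuous_on_id)
    moreover have "(LINT y|lborel. ?I y \<bullet> b) = (LINT y|lborel. ?I y) \<bullet> b"
      using iy by (rule integral_inner_left)
    ultimately show "(c *\<^sub>R (LINT y|lborel. ?I y)) \<bullet> b =
        ((LINT t:{0..1}|lborel. t ^ (DIM('a) - 1) * tail_F g (t * norm x)) *\<^sub>R x) \<bullet> b"
      unfolding I p by simp
  qed
qed

subsection \<open>The generalized Bayes estimator\<close>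

text \<open>The density has total mass 1, and reflection and translation preserve null sets. This is
  what keeps the denominator of the estimator away from 0.\<close>

lemma density_not_AE_zero:
  fixes f :: "real \<Rightarrow> real" and \<theta> :: "'a::euclidean_space"
  assumes M: "prob_space M" and X: "distributed M lborel X (\<lambda>x. ennreal (f (norm (x - \<theta>))))"
  shows "\<not> (AE y in lborel. f (norm (y :: 'a)) = 0)"
proof
  assume ae: "AE y in lborel. f (norm (y :: 'a)) = 0"
  interpret prob_space M by (rule M)
  have [measurable]: "(\<lambda>x. ennreal (f (norm (x - \<theta>)))) \<in> borel_measurable borel"
    using distributed_borel_measurable[OF X] by simp
  have "AE y in distr lborel borel (\<lambda>y. \<theta> - y). f (norm y) = 0"
    unfolding lborel_distr_reflect by (rule ae)
  then have "AE x in lborel. f (norm (\<theta> - x)) = 0"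
    by (rule AE_distrD[rotated]) simp
  then have "AE x in lborel. ennreal (f (norm (x - \<theta>))) = 0"
    by (simp add: norm_minus_commute[of \<theta>] ennreal_eq_0_iff) (auto elim: eventually_mono)
  then have "(\<integral>\<^sup>+ x. ennreal (f (norm (x - \<theta>))) \<partial>lborel) = 0"
    by (subst nn_integral_0_iff_AE) auto
  moreover have "emeasure (density lborel (\<lambda>x. ennreal (f (norm (x - \<theta>))))) UNIV = 1"
    using prob_space.emeasure_space_1[OF prob_space_distr[OF distributed_measurable[OF X]]]
    unfolding distributed_distr_eq_density[OF X] by simp
  ultimately show False by (simp add: emeasure_density)
qed


text \<open>At \<open>x = 0\<close> both the density and the prior depend on the norm of the
  integration variable only, so the vector integrand in the numerator is odd.\<close>

lemma gen_bayes_zero: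
  assumes "gen_bayes_well_defined f (harmonic_prior :: real ^ 'p \<Rightarrow> real)"
  shows "gen_bayes f harmonic_prior (0 :: real ^ 'p) = 0"
proof -
  let ?h = "\<lambda>\<theta>::real ^ 'p. (f (norm (0 - \<theta>)) * harmonic_prior \<theta>) *\<^sub>R \<theta>"
  have "integrable lborel ?h" using assms unfolding gen_bayes_well_defined_def by blast
  then have "?h \<in> borel_measurable borel" using borel_measurable_integrable by force
  then have "(LINT \<theta>|lborel. ?h \<theta>) = (LINT \<theta>|lborel. ?h (0 - \<theta>))"
    by (rule integral_lborel_reflect[symmetric])
  also have "\<dots> = (LINT \<theta>|lborel. - ?h \<theta>)"
    by (simp add: harmonic_prior_def)
  also have "\<dots> = - (LINT \<theta>|lborel. ?h \<theta>)" by (rule integral_minus)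
  finally have "(LINT \<theta>|lborel. ?h \<theta>) + (LINT \<theta>|lborel. ?h \<theta>) = 0"
    by (simp only: eq_neg_iff_add_eq_0)
  then have "(LINT \<theta>|lborel. ?h \<theta>) = 0"
    unfolding scaleR_2[symmetric] by (simp only: scaleR_eq_0_iff) simp
  then show ?thesis unfolding gen_bayes_def by (simp only: scaleR_zero_right)
qed

theorem mainTheorem3:
  fixes f :: "real \<Rightarrow> real"
    and M :: "'a measure" and X :: "'a \<Rightarrow> real ^ 'p" and \<theta> :: "real ^ 'p"
  assumes p_ge_3: "CARD('p) \<ge> 3"
    and M: "prob_space M"
    and f_nonneg: "\<And>s. s \<ge> 0 \<Longrightarrow> f s \<ge> 0"
    and X_density: "distributed M lborel X (\<lambda>x. ennreal (f (norm (x - \<theta>))))"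
    and well_defined: "gen_bayes_well_defined f (harmonic_prior :: real ^ 'p \<Rightarrow> real)"
  shows "\<forall>x :: real ^ 'p.
    gen_bayes f harmonic_prior x =
      (1 - (LINT t:{0..1}|lborel. t ^ (CARD('p) - 1) * tail_F f (t * norm x))
         / (LINT t:{0..1}|lborel. t ^ (CARD('p) - 3) * tail_F f (t * norm x))) *\<^sub>R x"
proof
  fix x :: "real ^ 'p"
  \<comment> \<open>\<open>f\<close> itself may fail to be measurable on the negative half-line.\<close>
  define g where "g s = f \<bar>s\<bar>" for s
  have g_norm: "f (norm y) = g (norm y)" for y :: "real ^ 'p" by (simp add: g_def)
  have g0: "g s \<ge> 0" for s by (simp add: g_def f_nonneg)
  have g [measurable]: "g \<in> borel_measurable borel"
  proof -
    have [measurable]: "(\<lambda>x. ennreal (f (norm (x - \<theta>)))) \<in> borel_measurable borel"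
      using distributed_borel_measurable[OF X_density] by simp
    \<comment> \<open>Along the line through \<open>\<theta>\<close> in a unit direction
      \<open>b\<close> the density is s \<mapsto> f |s|, so measurability on the space passes to
      \<open>g\<close>.\<close>
    obtain b :: "real ^ 'p" where b: "b \<in> Basis" using nonempty_Basis by blast
    have "(\<lambda>s. enn2real (ennreal (f (norm ((\<theta> + s *\<^sub>R b) - \<theta>))))) \<in> borel_measurable borel"
      by measurable
    then show ?thesis using b by (simp add: g_def[abs_def] f_nonneg)
  qed
  have tail: "tail_F f u = tail_F g u" if "u \<ge> 0" for u
    unfolding tail_F_def by (rule set_lebesgue_integral_cong) (use that in \<open>auto simp: g_def\<close>)
  let ?T = "\<lambda>n. LINT t:{0..1}|lborel. t ^ n * tail_F g (t * norm x)"
  have T: "(LINT t:{0..1}|lborel. t ^ n * tail_F f (t * norm x)) = ?T n" for n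
    by (rule set_lebesgue_integral_cong) (auto simp: tail)
  show "gen_bayes f harmonic_prior x =
      (1 - (LINT t:{0..1}|lborel. t ^ (CARD('p) - 1) * tail_F f (t * norm x))
         / (LINT t:{0..1}|lborel. t ^ (CARD('p) - 3) * tail_F f (t * norm x))) *\<^sub>R x"
  proof (cases "x = 0")
    case True
    then show ?thesis using gen_bayes_zero[OF well_defined] by simp
  next
    case False
    \<comment> \<open>The posterior integrand after the substitution y = x - \<theta>, which makes
      the density radial and moves the prior to the shifted kernel.\<close>
    define K where "K y = norm (x - y) powr (2 - real CARD('p)) * g (norm y)" for y
    have K0: "K y \<ge> 0" for y by (simp add: K_def g0)
    have K: "f (norm (x - (x - y))) * harmonic_prior (x - y) = K y" for y
      by (simp add: K_def harmonic_prior_def g_norm)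
    have prior_int: "integrable lborel (\<lambda>\<theta>. (f (norm (x - \<theta>)) * harmonic_prior \<theta>) *\<^sub>R \<theta>)"
      "integrable lborel (\<lambda>\<theta>. f (norm (x - \<theta>)) * harmonic_prior \<theta>)"
      using well_defined by (simp_all add: gen_bayes_well_defined_def)
    have iK: "integrable lborel K"
      using integrable_lborel_reflect[OF prior_int(2), of x] unfolding K .
    have iKx: "integrable lborel (\<lambda>y. K y *\<^sub>R (x - y))"
      using integrable_lborel_reflect[OF prior_int(1), of x] unfolding K .
    have iKy: "integrable lborel (\<lambda>y. K y *\<^sub>R y)"
    proof -
      have "integrable lborel (\<lambda>y. K y *\<^sub>R x - K y *\<^sub>R (x - y))"
        using iK iKx by (intro Bochner_Integration.integrable_diff integrable_scaleR_left)
      then show ?thesis by (simp add: scaleR_diff_right)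
    qed
    define D where "D = (LINT y|lborel. K y)"
    define N where "N = (LINT y|lborel. K y *\<^sub>R y)"
    have bayes: "gen_bayes f harmonic_prior x = (D *\<^sub>R x - N) /\<^sub>R D"
    proof -
      have "(LINT \<theta>|lborel. f (norm (x - \<theta>)) * harmonic_prior \<theta>) = D"
        using integral_lborel_reflect[of "\<lambda>\<theta>. f (norm (x - \<theta>)) * harmonic_prior \<theta>" x]
          borel_measurable_integrable[OF prior_int(2)]
        unfolding K D_def by simp
      moreover have "(LINT \<theta>|lborel. (f (norm (x - \<theta>)) * harmonic_prior \<theta>) *\<^sub>R \<theta>) = (LINT y|lborel. K y *\<^sub>R (x - y))"
        using integral_lborel_reflect[of "\<lambda>\<theta>. (f (norm (x - \<theta>)) * harmonic_prior \<theta>) *\<^sub>R \<theta>" x]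
          borel_measurable_integrable[OF prior_int(1)]
        unfolding K by simp
      moreover have "(LINT y|lborel. K y *\<^sub>R (x - y)) = D *\<^sub>R x - N"
        unfolding scaleR_diff_right D_def N_def using iK iKy by simp
      ultimately show ?thesis by (simp add: gen_bayes_def)
    qed
    define c where "c = Gamma (DIM(real ^ 'p) / 2 - 1) / (4 * pi powr (DIM(real ^ 'p) / 2))"
    have dim: "DIM(real ^ 'p) \<ge> 3" using p_ge_3 by simp
    have "Gamma (DIM(real ^ 'p) / 2 - 1) > 0" using dim by (intro Gamma_real_pos) simp
    then have c: "c > 0" by (simp add: c_def)
    have scalar: "c * D = ?T (CARD('p) - 3)"
      using newtonian_shrinkage(1)[OF dim g g0, of x] iK iKy
      unfolding c_def D_def K_def by simp
    have vector: "c *\<^sub>R N = ?T (CARD('p) - 1) *\<^sub>R x"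
      using newtonian_shrinkage(2)[OF dim g g0, of x] iK iKy
      unfolding c_def N_def K_def by simp
    have D: "D \<noteq> 0"
    proof
      assume "D = 0"
      then have "AE y in lborel. K y = 0"
        unfolding D_def using integral_nonneg_eq_0_iff_AE[OF iK] K0 by simp
      \<comment> \<open>The kernel is positive away from \<open>y = x\<close>; at that point
        \<open>powr\<close> gives 0, so \<open>K\<close> vanishes there whatever \<open>f\<close>
        is.\<close>
      then have "AE y in lborel. f (norm (y :: real ^ 'p)) = 0"
        using AE_lborel_singleton[of x] by eventually_elim (auto simp: K_def g_norm)
      then show False using density_not_AE_zero[OF M X_density] by simp
    qed
    \<comment> \<open>Expanding the quotient by \<open>c\<close> brings in exactly the two
      quantities known from \<open>scalar\<close> and \<open>vector\<close>.\<close>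
    have "(D *\<^sub>R x - N) /\<^sub>R D = x - (c *\<^sub>R N) /\<^sub>R (c * D)"
      using D c by (simp add: scaleR_diff_right)
    also have "\<dots> = (1 - ?T (CARD('p) - 1) / ?T (CARD('p) - 3)) *\<^sub>R x"
      unfolding vector scalar by (simp add: scaleR_diff_left divide_inverse mult.commute)
    finally show ?thesis unfolding bayes T .
  qed
qed

end
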